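(* Let $\Phi:\mathcal{A}\to\mathcal{B}$ be a tracial positive linear map between von Neumann algebras, let $\rho\in\mathcal{A}$ be self-adjoint, and let $(f,g)$ be a same monotonic pair of continuous real-valued functions defined on an interval containing the spectrum of $\rho$. Then for all self-adjoint $A,B\in\mathcal{A}$, \[ \begin{bmatrix} \mathrm{I}_{\rho,\Phi}^{f,g}(A) & \mathrm{Corr}_{\rho,\Phi}^{\prime f,g}(A,B)\\ \mathrm{Corr}_{\rho,\Phi}^{\prime f,g}(B,A) & \mathrm{I}_{\rho,\Phi}^{f,g}(B)\end{bmatrix} =\begin{bmatrix} \mathrm{I}_{\rho,\Phi}^{f,g}(A) & \mathrm{Re}\big(\mathrm{Corr}_{\rho,\Phi}^{f,g}(A,B)\big)\\ \mathrm{Re}\big(\mathrm{Corr}_{\rho,\Phi}^{f,g}(A,B)\big) & \mathrm{I}_{\rho,\Phi}^{f,g}(B)\end{bmatrix}\ \ge\ 0 \] in $M_2(\mathcal{B})$.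
   Context: A linear map $\Phi$ is tracial if $\Phi(XY)=\Phi(YX)$ for all $X,Y$ in its domain, and positive if it maps positive elements to positive elements. A pair $(f,g)$ of real-valued functions on a set $D$ is same monotonic if $(f(x)-f(y))(g(x)-g(y))\ge 0$ for all $x,y\in D$. $\mathrm{Re}(X):=(X+X^* )/2$. The generalized correlation is $\mathrm{Corr}_{\rho,\Phi}^{f,g}(A,B):=\Phi(f(\rho)g(\rho)A^*B)-\Phi(f(\rho)A^*g(\rho)B)$, the generalized skew information is $\mathrm{I}_{\rho,\Phi}^{f,g}(A):=\mathrm{Corr}_{\rho,\Phi}^{f,g}(A,A)$, and the generalized symmetric correlation is $\mathrm{Corr}_{\rho,\Phi}^{\prime f,g}(A,B):=\tfrac12\big(\mathrm{Corr}_{\rho,\Phi}^{f,g}(A,B)+\mathrm{Corr}_{\rho,\Phi}^{f,g}(B^*,A^* )\big)$. *)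

theory Defs
  imports "HOL-Analysis.Analysis" "HOL-Computational_Algebra.Polynomial"
begin

class cstar_algebra = real_normed_algebra_1 + complete_space +
  fixes scaleC :: "complex \<Rightarrow> 'a \<Rightarrow> 'a"
    and adj :: "'a \<Rightarrow> 'a"
  assumes scaleC_add_right: "scaleC c (x + y) = scaleC c x + scaleC c y"
    and scaleC_add_left: "scaleC (c + d) x = scaleC c x + scaleC d x"
    and scaleC_scaleC: "scaleC c (scaleC d x) = scaleC (c * d) x"
    and scaleC_one: "scaleC 1 x = x"
    and scaleR_scaleC: "scaleR r x = scaleC (complex_of_real r) x"
    and norm_scaleC: "norm (scaleC c x) = cmod c * norm x"
    and scaleC_mult_left: "scaleC c x * y = scaleC c (x * y)"
    and scaleC_mult_right: "x * scaleC c y = scaleC c (x * y)"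
    and adj_adj: "adj (adj x) = x"
    and adj_add: "adj (x + y) = adj x + adj y"
    and adj_mult: "adj (x * y) = adj y * adj x"
    and adj_scaleC: "adj (scaleC c x) = scaleC (cnj c) (adj x)"
    and cstar_identity: "norm (adj x * x) = (norm x)\<^sup>2"

definition selfadjoint :: "'a::cstar_algebra \<Rightarrow> bool" where
  "selfadjoint x \<longleftrightarrow> adj x = x"

definition invertible_elem :: "'a::cstar_algebra \<Rightarrow> bool" where
  "invertible_elem x \<longleftrightarrow> (\<exists>y. x * y = 1 \<and> y * x = 1)"

definition spectrum :: "'a::cstar_algebra \<Rightarrow> complex set" where
  "spectrum x = {z. \<not> invertible_elem (x - scaleC z 1)}"

definition positive_elem :: "'a::cstar_algebra \<Rightarrow> bool" where
  "positive_elem x \<longleftrightarrow> selfadjoint x \<and> spectrum x \<subseteq> complex_of_real ` {0..}"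

definition cle :: "'a::cstar_algebra \<Rightarrow> 'a \<Rightarrow> bool" where
  "cle x y \<longleftrightarrow> positive_elem (y - x)"

definition Re_elem :: "'a::cstar_algebra \<Rightarrow> 'a" where
  "Re_elem x = scaleC (1/2) (x + adj x)"

definition poly_eval :: "real poly \<Rightarrow> 'a::cstar_algebra \<Rightarrow> 'a" where
  "poly_eval p x = (\<Sum>i\<le>degree p. scaleC (complex_of_real (coeff p i)) (x ^ i))"

definition cfc :: "(real \<Rightarrow> real) \<Rightarrow> 'a::cstar_algebra \<Rightarrow> 'a" where
  "cfc f x = (THE y. \<forall>p :: nat \<Rightarrow> real poly.
      uniform_limit (Re ` spectrum x) (\<lambda>n t. poly (p n) t) f sequentially
        \<longrightarrow> (\<lambda>n. poly_eval (p n) x) \<longlonglongrightarrow> y)"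

definition directed_up :: "'a::cstar_algebra set \<Rightarrow> bool" where
  "directed_up D \<longleftrightarrow> (\<forall>x\<in>D. \<forall>y\<in>D. \<exists>z\<in>D. cle x z \<and> cle y z)"

definition is_lub_sa :: "'a::cstar_algebra set \<Rightarrow> 'a \<Rightarrow> bool" where
  "is_lub_sa D s \<longleftrightarrow> selfadjoint s \<and> (\<forall>x\<in>D. cle x s) \<and>
      (\<forall>u. selfadjoint u \<and> (\<forall>x\<in>D. cle x u) \<longrightarrow> cle s u)"

definition bounded_directed :: "'a::cstar_algebra set \<Rightarrow> bool" where
  "bounded_directed D \<longleftrightarrow> D \<noteq> {} \<and> (\<forall>x\<in>D. selfadjoint x) \<and> directed_up D \<and>
      (\<exists>u. selfadjoint u \<and> (\<forall>x\<in>D. cle x u))"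

definition complex_linear :: "('a::cstar_algebra \<Rightarrow> 'b) \<Rightarrow> ('b \<Rightarrow> 'b \<Rightarrow> 'b) \<Rightarrow> (complex \<Rightarrow> 'b \<Rightarrow> 'b) \<Rightarrow> bool" where
  "complex_linear \<phi> pl sc \<longleftrightarrow> (\<forall>x y. \<phi> (x + y) = pl (\<phi> x) (\<phi> y)) \<and> (\<forall>c x. \<phi> (scaleC c x) = sc c (\<phi> x))"

definition normal_state :: "('a::cstar_algebra \<Rightarrow> complex) \<Rightarrow> bool" where
  "normal_state \<phi> \<longleftrightarrow> complex_linear \<phi> (+) (*) \<and> \<phi> 1 = 1 \<and>
     (\<forall>x. positive_elem x \<longrightarrow> \<phi> x \<in> complex_of_real ` {0..}) \<and>
     (\<forall>D s. bounded_directed D \<and> is_lub_sa D s \<longrightarrow> Re (\<phi> s) = (SUP x\<in>D. Re (\<phi> x)))"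

text \<open>A C*-algebra is a von Neumann algebra (W*-algebra) iff it is monotone complete
  and admits a separating family of normal states (Kadison).\<close>
definition vn_algebra :: "'a::cstar_algebra itself \<Rightarrow> bool" where
  "vn_algebra (_ :: 'a itself) \<longleftrightarrow>
     (\<forall>D :: 'a set. bounded_directed D \<longrightarrow> (\<exists>s. is_lub_sa D s)) \<and>
     (\<forall>x :: 'a. positive_elem x \<and> x \<noteq> 0 \<longrightarrow> (\<exists>\<phi>. normal_state \<phi> \<and> \<phi> x \<noteq> 0))"

definition linear_map :: "('a::cstar_algebra \<Rightarrow> 'b::cstar_algebra) \<Rightarrow> bool" where
  "linear_map \<Phi> \<longleftrightarrow> complex_linear \<Phi> (+) scaleC"

definition positive_map :: "('a::cstar_algebra \<Rightarrow> 'b::cstar_algebra) \<Rightarrow> bool" where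
  "positive_map \<Phi> \<longleftrightarrow> (\<forall>x. positive_elem x \<longrightarrow> positive_elem (\<Phi> x))"

definition tracial :: "('a::cstar_algebra \<Rightarrow> 'b::cstar_algebra) \<Rightarrow> bool" where
  "tracial \<Phi> \<longleftrightarrow> (\<forall>x y. \<Phi> (x * y) = \<Phi> (y * x))"

definition same_monotonic :: "(real \<Rightarrow> real) \<Rightarrow> (real \<Rightarrow> real) \<Rightarrow> real set \<Rightarrow> bool" where
  "same_monotonic f g D \<longleftrightarrow> (\<forall>x\<in>D. \<forall>y\<in>D. (f x - f y) * (g x - g y) \<ge> 0)"

definition Corr :: "'a::cstar_algebra \<Rightarrow> ('a \<Rightarrow> 'b::cstar_algebra) \<Rightarrow> (real \<Rightarrow> real) \<Rightarrow> (real \<Rightarrow> real) \<Rightarrow> 'a \<Rightarrow> 'a \<Rightarrow> 'b" where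
  "Corr \<rho> \<Phi> f g A B = \<Phi> (cfc f \<rho> * cfc g \<rho> * adj A * B) - \<Phi> (cfc f \<rho> * adj A * cfc g \<rho> * B)"

definition SkewI :: "'a::cstar_algebra \<Rightarrow> ('a \<Rightarrow> 'b::cstar_algebra) \<Rightarrow> (real \<Rightarrow> real) \<Rightarrow> (real \<Rightarrow> real) \<Rightarrow> 'a \<Rightarrow> 'b" where
  "SkewI \<rho> \<Phi> f g A = Corr \<rho> \<Phi> f g A A"

definition CorrSym :: "'a::cstar_algebra \<Rightarrow> ('a \<Rightarrow> 'b::cstar_algebra) \<Rightarrow> (real \<Rightarrow> real) \<Rightarrow> (real \<Rightarrow> real) \<Rightarrow> 'a \<Rightarrow> 'a \<Rightarrow> 'b" where
  "CorrSym \<rho> \<Phi> f g A B = scaleC (1/2) (Corr \<rho> \<Phi> f g A B + Corr \<rho> \<Phi> f g (adj B) (adj A))"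

text \<open>(a, b, c, d) represents the block matrix [[a, b], [c, d]].\<close>
type_synonym 'a mat2 = "'a \<times> 'a \<times> 'a \<times> 'a"

fun m2_mult :: "'a::cstar_algebra mat2 \<Rightarrow> 'a mat2 \<Rightarrow> 'a mat2" where
  "m2_mult (a, b, c, d) (a', b', c', d') =
     (a * a' + b * c', a * b' + b * d', c * a' + d * c', c * b' + d * d')"

fun m2_adj :: "'a::cstar_algebra mat2 \<Rightarrow> 'a mat2" where
  "m2_adj (a, b, c, d) = (adj a, adj c, adj b, adj d)"

definition m2_invertible :: "'a::cstar_algebra mat2 \<Rightarrow> bool" where
  "m2_invertible X \<longleftrightarrow> (\<exists>Y. m2_mult X Y = (1, 0, 0, 1) \<and> m2_mult Y X = (1, 0, 0, 1))"

fun m2_spectrum :: "'a::cstar_algebra mat2 \<Rightarrow> complex set" where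
  "m2_spectrum (a, b, c, d) = {z. \<not> m2_invertible (a - scaleC z 1, b, c, d - scaleC z 1)}"

definition m2_positive :: "'a::cstar_algebra mat2 \<Rightarrow> bool" where
  "m2_positive X \<longleftrightarrow> m2_adj X = X \<and> m2_spectrum X \<subseteq> complex_of_real ` {0..}"

end

theory Submission
  imports Defs "HOL-Computational_Algebra.Fundamental_Theorem_Algebra"
begin

text \<open>
  Traciality turns the quadratic form of the matrix into a combination, with nonnegative weights
  \<open>(f s - f t) (g s - g t)\<close>, of Gram-type forms built from \<open>X = u A u'\<close> and \<open>Y = u B u'\<close>, where
  \<open>u\<close>, \<open>u'\<close> run through square roots of a partition of unity in the functional calculus of \<open>\<rho>\<close>.
  What remains is a two-positivity property of \<open>\<Phi>\<close>: composing \<open>\<Phi>\<close> with a normal state and two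
  vectors gives tracial functionals \<open>p\<close>, \<open>q\<close>, \<open>r\<close> with \<open>s\<^sup>2 p + 2 s t q + t\<^sup>2 r \<ge> 0\<close> for all real
  \<open>s\<close>, \<open>t\<close>, and one needs \<open>p (X X\<^sup>*) + 2 q (X Y\<^sup>*) + r (Y Y\<^sup>*) \<ge> 0\<close>. Neither a centre-valued trace nor
  the bidual is used: iterated approximate Hahn decompositions of \<open>q - t r\<close> write the unit as a sum of
  positive \<open>d\<close> under each of which \<open>q\<close> is nearly \<open>t r\<close> for some real \<open>t\<close>, hence \<open>p\<close> is nearly above
  \<open>t\<^sup>2 r\<close>, and the form is nearly at least \<open>r (Z\<^sup>* d Z) \<ge> 0\<close> for \<open>Z = t X + Y\<close>. Positivity in \<open>M\<^sub>2\<close>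
  follows from that of all the vector forms by Schur complements.
\<close>

text \<open>Guide for the slicing: on a commutative algebra \<open>p\<close>, \<open>q\<close>,
  \<open>r\<close> are measures. If q = h r, the choice s = 1, t = -h in the assumed form gives p
  \<ge> h^2 r, and the Gram form is at least the r-integral of |h X + Y|^2. Three things fail
  without commutativity. There need be no density h; finitely many thresholds replace it. The
  regions where q exceeds t r need not be nested for different t; nesting is forced by maximising
  each functional only below the preceding element. A slice d need not commute with X or Y; writing
  d = e e, traciality gives r (w d) = r (e w e), which is monotone in w. Finitely many thresholds
  suffice only if q is bounded by a multiple of r, which is arranged by adding a small multiple of p
  + r to r.

  The groundwork avoids representations: the binomial series of the square root, absolutely
  convergent on the closed unit ball, and the C*-identity together yield real spectra, a norm
  attained on the spectrum, and positivity as a norm inequality.\<close>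

instance cstar_algebra \<subseteq> banach ..

section \<open>Elementary algebra of complex scalars and adjoints\<close>

lemma scaleC_zero_left [simp]: "scaleC 0 (x::'a::cstar_algebra) = 0"
  using norm_scaleC[of 0 x] by simp

lemma scaleC_zero_right [simp]: "scaleC c (0::'a::cstar_algebra) = 0"
  using norm_scaleC[of c "0::'a"] by simp

lemma scaleC_minus_right: "scaleC c (- x) = - scaleC c (x::'a::cstar_algebra)"
  by (metis add.inverse_inverse add_eq_0_iff scaleC_add_right scaleC_zero_right)

lemma scaleC_diff_right: "scaleC c (x - y) = scaleC c x - scaleC c (y::'a::cstar_algebra)"
  using scaleC_add_right[of c x "- y"] by (simp add: scaleC_minus_right)

lemma scaleC_minus_left: "scaleC (- c) x = - scaleC c (x::'a::cstar_algebra)"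
  by (metis add.inverse_inverse add_eq_0_iff scaleC_add_left scaleC_zero_left)

lemma scaleC_diff_left: "scaleC (c - d) x = scaleC c x - scaleC d (x::'a::cstar_algebra)"
  using scaleC_add_left[of c "- d" x] by (simp add: scaleC_minus_left)

lemma scaleC_of_real: "scaleC (complex_of_real r) x = r *\<^sub>R (x::'a::cstar_algebra)"
  by (simp add: scaleR_scaleC)

lemma scaleC_of_real_one: "scaleC (complex_of_real r) (1::'a::cstar_algebra) = of_real r"
  unfolding scaleC_of_real by (simp add: of_real_def)

lemma adj_zero [simp]: "adj (0::'a::cstar_algebra) = 0"
  by (metis add_cancel_right_right adj_add)

lemma adj_one [simp]: "adj (1::'a::cstar_algebra) = 1"
  by (metis adj_adj adj_mult mult.right_neutral)

lemma adj_minus: "adj (- x) = - adj (x::'a::cstar_algebra)"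
  by (metis add.inverse_inverse add_eq_0_iff adj_add adj_zero)

lemma adj_diff: "adj (x - y) = adj x - adj (y::'a::cstar_algebra)"
  using adj_add[of x "- y"] by (simp add: adj_minus)

lemma adj_scaleR: "adj (r *\<^sub>R x) = r *\<^sub>R adj (x::'a::cstar_algebra)"
  by (simp add: scaleR_scaleC adj_scaleC)

lemma adj_of_real [simp]: "adj (of_real r :: 'a::cstar_algebra) = of_real r"
  by (simp add: of_real_def adj_scaleR)

lemma adj_power: "adj (x ^ n) = adj (x::'a::cstar_algebra) ^ n"
  by (induction n) (auto simp: adj_mult power_commutes)

lemma norm_adj [simp]: "norm (adj (x::'a::cstar_algebra)) = norm x"
proof -
  have le: "norm y \<le> norm (adj y)" for y :: 'a
  proof (cases "norm y = 0")
    case False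
    have "norm y * norm y \<le> norm (adj y) * norm y"
      using cstar_identity[of y] norm_mult_ineq[of "adj y" y] by (simp add: power2_eq_square)
    with False show ?thesis by simp
  qed simp
  show ?thesis using le[of x] le[of "adj x"] by (simp add: adj_adj)
qed

lemma bounded_linear_adj: "bounded_linear (adj :: 'a::cstar_algebra \<Rightarrow> 'a)"
  by (rule bounded_linear_intro[of _ 1]) (auto simp: adj_add adj_scaleR)

lemma adj_sum: "adj (sum f S) = (\<Sum>i\<in>S. adj (f i :: 'a::cstar_algebra))"
  by (induction S rule: infinite_finite_induct) (auto simp: adj_add)

lemma norm_square_selfadjoint: "adj h = h \<Longrightarrow> norm (h * h) = (norm (h::'a::cstar_algebra))\<^sup>2"
  using cstar_identity[of h] by simp

lemma adj_mult_self_eq_0: "adj x * x = 0 \<Longrightarrow> (x::'a::cstar_algebra) = 0"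
  using cstar_identity[of x] by simp

subsection \<open>Square roots by the binomial series\<close>

text \<open>The Taylor coefficients at 0 of the square root of 1 - y.\<close>

definition bcoef :: "nat \<Rightarrow> real" where
  "bcoef n = pochhammer (- 1 / 2) n / fact n"

lemma bcoef_0 [simp]: "bcoef 0 = 1"
  by (simp add: bcoef_def)

lemma bcoef_Suc_nonpos: "bcoef (Suc n) \<le> 0"
proof -
  have "pochhammer (1 / 2 :: real) n \<ge> 0"
    by (rule pochhammer_nonneg) auto
  then show ?thesis
    by (simp add: bcoef_def pochhammer_rec divide_simps)
qed

lemma bcoef_gbinomial: "bcoef n = (1 / 2 gchoose n) * (- 1) ^ n"
  by (simp add: bcoef_def gbinomial_pochhammer flip: power_mult_distrib)

text \<open>Alternating partial sums of binomial coefficients have a closed form; here it is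
  \<open>pochhammer (1/2) m / fact m\<close>.\<close>

lemma bcoef_sum_nonneg: "(\<Sum>k\<le>m. bcoef k) \<ge> 0"
proof -
  have "pochhammer (1 / 2 :: real) m \<ge> 0"
    by (rule pochhammer_nonneg) auto
  then show ?thesis
    by (simp only: bcoef_gbinomial gbinomial_sum_lower_neg)
      (simp add: gbinomial_pochhammer flip: power_mult_distrib)
qed

text \<open>The coefficients after the first are nonpositive and the partial sums stay nonnegative,
  so their absolute values cannot outweigh the leading 1. This gives absolute convergence on the
  closed unit ball, boundary included.\<close>

lemma bcoef_abs_sum: "(\<Sum>k<n. \<bar>bcoef (Suc k)\<bar>) \<le> 1"
proof -
  have "(\<Sum>k<n. \<bar>bcoef (Suc k)\<bar>) = - (\<Sum>k<n. bcoef (Suc k))"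
    using bcoef_Suc_nonpos by (simp add: abs_of_nonpos flip: sum_negf)
  also have "\<dots> = 1 - (\<Sum>k\<le>n. bcoef k)"
    by (simp add: lessThan_Suc_atMost[symmetric] sum.lessThan_Suc_shift del: sum.lessThan_Suc)
  finally show ?thesis using bcoef_sum_nonneg[of n] by simp
qed

lemma summable_abs_bcoef: "summable (\<lambda>n. \<bar>bcoef n\<bar>)"
proof -
  have "summable (\<lambda>n. \<bar>bcoef (Suc n)\<bar>)"
    by (rule summableI_nonneg_bounded[of _ 1]) (auto simp: bcoef_abs_sum)
  then show ?thesis by (rule summable_Suc_iff[THEN iffD1])
qed

text \<open>Vandermonde with 1/2 + 1/2 = 1: the Cauchy square of the series has the coefficients of
  1 - y.\<close>

lemma bcoef_convolution:
  "(\<Sum>i\<le>n. bcoef i * bcoef (n - i)) = (if n = 0 then 1 else if n = 1 then - 1 else 0)"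
proof -
  have "(\<Sum>i\<le>n. bcoef i * bcoef (n - i)) = (\<Sum>i\<le>n. (1/2 gchoose i) * (1/2 gchoose (n - i)) * (- 1) ^ n)"
    by (intro sum.cong) (auto simp: bcoef_gbinomial simp flip: power_add)
  also have "\<dots> = ((1/2 + 1/2 :: real) gchoose n) * (- 1) ^ n"
    using gbinomial_Vandermonde[of "1/2::real" "1/2" n] by (simp add: atLeast0AtMost flip: sum_distrib_right)
  also have "(1/2 + 1/2 :: real) gchoose n = of_nat (1 choose n)"
    using binomial_gbinomial[of 1 n, where ?'a = real] by simp
  finally show ?thesis
    by (cases "n = 0 \<or> n = 1") (auto simp: binomial_eq_0)
qed

definition sqrt1m :: "'a \<Rightarrow> 'a::{real_normed_algebra_1,banach}" where
  "sqrt1m y = (\<Sum>n. bcoef n *\<^sub>R y ^ n)"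

context
  fixes y :: "'a::{real_normed_algebra_1,banach}"
  assumes y: "norm y \<le> 1"
begin

lemma norm_bcoef_term: "norm (bcoef n *\<^sub>R y ^ n) \<le> \<bar>bcoef n\<bar>"
proof -
  have "norm (y ^ n) \<le> 1"
    using norm_power_ineq[of y n] power_le_one[of "norm y" n] y by simp
  then show ?thesis by (simp add: mult_left_le)
qed

lemma summable_norm_sqrt1m: "summable (\<lambda>n. norm (bcoef n *\<^sub>R y ^ n))"
  by (rule summable_comparison_test'[OF summable_abs_bcoef, of 0]) (use norm_bcoef_term in simp)

lemma sqrt1m_sums: "(\<lambda>n. bcoef n *\<^sub>R y ^ n) sums sqrt1m y"
  unfolding sqrt1m_def by (rule summable_sums[OF summable_norm_cancel[OF summable_norm_sqrt1m]])

lemma sqrt1m_square: "sqrt1m y * sqrt1m y = 1 - y"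
proof -
  have eq: "(\<Sum>i\<le>k. (bcoef i *\<^sub>R y ^ i) * (bcoef (k - i) *\<^sub>R y ^ (k - i)))
      = (if k = 0 then 1 else if k = 1 then - y else 0)" for k
  proof -
    have "(\<Sum>i\<le>k. (bcoef i *\<^sub>R y ^ i) * (bcoef (k - i) *\<^sub>R y ^ (k - i)))
        = (\<Sum>i\<le>k. (bcoef i * bcoef (k - i)) *\<^sub>R y ^ k)"
      by (intro sum.cong) (auto simp flip: power_add)
    also have "\<dots> = (\<Sum>i\<le>k. bcoef i * bcoef (k - i)) *\<^sub>R y ^ k"
      by (simp add: scaleR_sum_left)
    finally show ?thesis unfolding bcoef_convolution by auto
  qed
  have "(\<lambda>k. if k = 0 then 1 else if k = 1 then - y else 0) sums (sqrt1m y * sqrt1m y)"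
    using Cauchy_product_sums[OF summable_norm_sqrt1m summable_norm_sqrt1m]
    unfolding eq sqrt1m_def .
  moreover have "(\<lambda>k. if k = 0 then 1 else if k = 1 then - y else 0) sums
      (\<Sum>k\<in>{0,1::nat}. if k = 0 then 1 else if k = 1 then - y else 0)"
    by (rule sums_finite) auto
  ultimately have "sqrt1m y * sqrt1m y = (\<Sum>k\<in>{0,1::nat}. if k = 0 then 1 else if k = 1 then - y else 0)"
    by (rule sums_unique2)
  then show ?thesis by simp
qed

text \<open>Places the root in the closed ball of radius 1 about 1, which is the norm criterion for
  positivity; this is how square roots later turn out positive.\<close>

lemma norm_one_minus_sqrt1m: "norm (1 - sqrt1m y) \<le> 1"
proof -
  have s: "summable (\<lambda>n. norm (bcoef (Suc n) *\<^sub>R y ^ Suc n))"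
    by (rule summable_Suc_iff[THEN iffD2, OF summable_norm_sqrt1m])
  have s1: "summable (\<lambda>n. \<bar>bcoef (Suc n)\<bar>)"
    by (rule summable_Suc_iff[THEN iffD2, OF summable_abs_bcoef])
  have "sqrt1m y = 1 + (\<Sum>n. bcoef (Suc n) *\<^sub>R y ^ Suc n)"
    using suminf_split_head[OF summable_norm_cancel[OF summable_norm_sqrt1m]]
    by (simp add: sqrt1m_def)
  then have "norm (1 - sqrt1m y) = norm (\<Sum>n. bcoef (Suc n) *\<^sub>R y ^ Suc n)"
    by simp
  also have "\<dots> \<le> (\<Sum>n. norm (bcoef (Suc n) *\<^sub>R y ^ Suc n))"
    by (rule summable_norm[OF s])
  also have "\<dots> \<le> (\<Sum>n. \<bar>bcoef (Suc n)\<bar>)"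
    by (intro suminf_le s norm_bcoef_term s1)
  also have "\<dots> \<le> 1"
    by (rule suminf_le_const[OF s1 bcoef_abs_sum])
  finally show ?thesis .
qed

lemma sqrt1m_commute:
  assumes "x * y = y * x"
  shows "x * sqrt1m y = sqrt1m y * x"
proof -
  have c: "x * y ^ n = y ^ n * x" for n
    by (induction n) (auto simp: mult.assoc[symmetric] assms, simp add: mult.assoc)
  have s: "summable (\<lambda>n. bcoef n *\<^sub>R y ^ n)"
    by (rule summable_norm_cancel[OF summable_norm_sqrt1m])
  show ?thesis
    unfolding sqrt1m_def suminf_mult[OF s, symmetric] suminf_mult2[OF s]
    by (simp add: c)
qed

end

lemma adj_sqrt1m:
  fixes y :: "'a::cstar_algebra"
  assumes "norm y \<le> 1" "adj y = y"
  shows "adj (sqrt1m y) = sqrt1m y"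
proof -
  have "(\<lambda>n. adj (bcoef n *\<^sub>R y ^ n)) sums adj (sqrt1m y)"
    by (rule bounded_linear.sums[OF bounded_linear_adj sqrt1m_sums[OF assms(1)]])
  moreover have "adj (bcoef n *\<^sub>R y ^ n) = bcoef n *\<^sub>R y ^ n" for n
    by (simp add: adj_scaleR adj_power assms(2))
  ultimately have "(\<lambda>n. bcoef n *\<^sub>R y ^ n) sums adj (sqrt1m y)"
    by simp
  then show ?thesis
    by (rule sums_unique2[OF _ sqrt1m_sums[OF assms(1)]])
qed

subsection \<open>Spectrum and positivity\<close>

lemma invertible_elemI: "l * x = 1 \<Longrightarrow> x * r = 1 \<Longrightarrow> invertible_elem x"
  unfolding invertible_elem_def by (metis mult.assoc mult.left_neutral mult.right_neutral)

lemma invertible_elem_one_minus: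
  fixes y :: "'a::cstar_algebra"
  assumes "norm y < 1"
  shows "invertible_elem (1 - y)"
proof -
  have s: "summable (\<lambda>n. y ^ n)"
    by (rule summable_norm_cancel, rule summable_comparison_test'[OF summable_geometric[of "norm y"], of 0])
      (use assms in \<open>auto intro: norm_power_ineq\<close>)
  let ?s = "\<Sum>n. y ^ n"
  have "(\<Sum>n. y ^ Suc n) = ?s - 1"
    using suminf_split_head[OF s] by simp
  moreover have "(\<Sum>n. y ^ Suc n) = y * ?s"
    using suminf_mult[OF s, of y] by simp
  moreover have "(\<Sum>n. y ^ Suc n) = ?s * y"
    using suminf_mult2[OF s, of y] by (simp add: power_commutes)
  ultimately have "?s * (1 - y) = 1" "(1 - y) * ?s = 1"
    by (simp_all add: algebra_simps)
  then show ?thesis by (rule invertible_elemI)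
qed

lemma invertible_elem_scaleC:
  fixes x :: "'a::cstar_algebra"
  assumes "invertible_elem x" "c \<noteq> 0"
  shows "invertible_elem (scaleC c x)"
proof -
  obtain y where "x * y = 1" "y * x = 1"
    using assms(1) by (auto simp: invertible_elem_def)
  then show ?thesis
    using assms(2)
    by (intro invertible_elemI[of "scaleC (1/c) y" _ "scaleC (1/c) y"])
      (auto simp: scaleC_mult_left scaleC_mult_right scaleC_scaleC scaleC_one)
qed

lemma invertible_elem_mult:
  fixes x y :: "'a::cstar_algebra"
  assumes "invertible_elem x" "invertible_elem y"
  shows "invertible_elem (x * y)"
proof -
  obtain x' y' where "x * x' = 1" "x' * x = 1" "y * y' = 1" "y' * y = 1"
    using assms by (auto simp: invertible_elem_def)
  then have "(y' * x') * (x * y) = 1" "(x * y) * (y' * x') = 1"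
    by (metis mult.assoc mult.right_neutral)+
  then show ?thesis by (rule invertible_elemI)
qed

lemma invertible_elem_commuting_factor:
  fixes x y :: "'a::cstar_algebra"
  assumes "invertible_elem (x * y)" "x * y = y * x"
  shows "invertible_elem x"
proof -
  obtain z where z: "(x * y) * z = 1" "z * (x * y) = 1"
    using assms by (auto simp: invertible_elem_def)
  have "z * y * x = 1" using z(2) assms(2) by (simp add: mult.assoc)
  moreover have "x * (y * z) = 1" using z(1) by (simp add: mult.assoc)
  ultimately show ?thesis by (rule invertible_elemI)
qed

text \<open>Neumann series for a / t. Nearly every invertibility claim below is brought to this
  form, a real centre t with a strictly smaller distance.\<close>

lemma invertible_elem_near_of_real:
  fixes a :: "'a::cstar_algebra"
  assumes "norm (of_real t - a) < t"
  shows "invertible_elem a"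
proof -
  have t: "t > 0" using assms norm_ge_zero[of "of_real t - a"] by linarith
  have "1 - (1/t) *\<^sub>R (of_real t - a) = (1/t) *\<^sub>R a"
    using t by (simp add: algebra_simps of_real_def)
  moreover have "norm ((1/t) *\<^sub>R (of_real t - a)) < 1"
    using t assms by (simp add: divide_simps)
  ultimately have "invertible_elem ((1/t) *\<^sub>R a)"
    using invertible_elem_one_minus by metis
  then have "invertible_elem (scaleC (of_real t) ((1/t) *\<^sub>R a))"
    by (rule invertible_elem_scaleC) (use t in simp)
  then show ?thesis using t by (simp add: scaleC_of_real)
qed

lemma invertible_elem_near:
  fixes x y :: "'a::cstar_algebra"
  assumes "x * y = 1" "y * x = 1" "norm (x - x') * norm y < 1"
  shows "invertible_elem x'"
proof -
  have "norm ((x - x') * y) < 1"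
    using norm_mult_ineq[of "x - x'" y] assms(3) by linarith
  then have "invertible_elem (1 - (x - x') * y)"
    by (rule invertible_elem_one_minus)
  moreover have "invertible_elem x"
    by (rule invertible_elemI[OF assms(2,1)])
  ultimately have "invertible_elem ((1 - (x - x') * y) * x)"
    by (rule invertible_elem_mult)
  moreover have "(1 - (x - x') * y) * x = x'"
    using assms by (simp add: algebra_simps)
  ultimately show ?thesis by simp
qed

lemma spectrum_iff: "z \<in> spectrum x \<longleftrightarrow> \<not> invertible_elem (x - scaleC z 1)"
  by (simp add: spectrum_def)

lemma norm_spectrum_le:
  fixes x :: "'a::cstar_algebra"
  assumes "z \<in> spectrum x"
  shows "cmod z \<le> norm x"
proof (rule ccontr)
  assume "\<not> ?thesis"
  then have z: "norm x < cmod z" by simp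
  then have z0: "z \<noteq> 0" using norm_ge_zero[of x] by auto
  have "norm (scaleC (1/z) x) < 1"
    using z z0 by (simp add: norm_scaleC norm_divide)
  then have "invertible_elem (scaleC (- z) (1 - scaleC (1/z) x))"
    using z0 by (intro invertible_elem_scaleC invertible_elem_one_minus) auto
  moreover have "scaleC (- z) (1 - scaleC (1/z) x) = x - scaleC z 1"
    using z0 by (simp add: scaleC_diff_right scaleC_scaleC scaleC_one scaleC_minus_left)
  ultimately show False using assms by (simp add: spectrum_iff)
qed

lemma closed_spectrum: "closed (spectrum (x :: 'a::cstar_algebra))"
proof -
  have "open (- spectrum x)"
    unfolding open_dist
  proof (intro ballI)
    fix z assume "z \<in> - spectrum x"
    then obtain y where y: "(x - scaleC z 1) * y = 1" "y * (x - scaleC z 1) = 1"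
      by (auto simp: spectrum_iff invertible_elem_def)
    have y0: "norm y > 0" using y by auto
    have "z' \<in> - spectrum x" if "dist z' z < 1 / norm y" for z'
    proof -
      have "x - scaleC z 1 - (x - scaleC z' 1) = scaleC (z' - z) 1"
        by (simp add: scaleC_diff_left)
      then have "norm (x - scaleC z 1 - (x - scaleC z' 1)) * norm y < 1"
        using that y0 by (simp add: norm_scaleC dist_norm field_simps)
      from invertible_elem_near[OF y this] show ?thesis by (simp add: spectrum_iff)
    qed
    then show "\<exists>e>0. \<forall>z'. dist z' z < e \<longrightarrow> z' \<in> - spectrum x"
      using y0 by (intro exI[of _ "1 / norm y"]) auto
  qed
  then show ?thesis by (simp add: closed_def)
qed

text \<open>Jacobson's identity: if c inverts a b - z, then (b c a - 1) / z inverts b a - z.\<close>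

lemma spectrum_mult_commute:
  fixes a b :: "'a::cstar_algebra"
  assumes "z \<in> spectrum (b * a)" "z \<noteq> 0"
  shows "z \<in> spectrum (a * b)"
proof (rule ccontr)
  assume "z \<notin> spectrum (a * b)"
  then obtain c where c: "(a * b - scaleC z 1) * c = 1" "c * (a * b - scaleC z 1) = 1"
    by (auto simp: spectrum_iff invertible_elem_def)
  have e1: "a * b * c = 1 + scaleC z c" and e2: "c * a * b = 1 + scaleC z c"
    using c by (simp_all add: algebra_simps scaleC_mult_left scaleC_mult_right)
  have "(b * a - scaleC z 1) * (b * c * a - 1) = b * (a * b * c) * a - scaleC z (b * c * a) - b * a + scaleC z 1"
    by (simp add: algebra_simps scaleC_mult_left)
  also have "\<dots> = scaleC z 1"
    unfolding e1 by (simp add: algebra_simps scaleC_mult_left scaleC_mult_right)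
  finally have r: "(b * a - scaleC z 1) * (b * c * a - 1) = scaleC z 1" .
  have "(b * c * a - 1) * (b * a - scaleC z 1) = b * (c * a * b) * a - scaleC z (b * c * a) - b * a + scaleC z 1"
    by (simp add: algebra_simps scaleC_mult_right scaleC_diff_right)
  also have "\<dots> = scaleC z 1"
    unfolding e2 by (simp add: algebra_simps scaleC_mult_left scaleC_mult_right)
  finally have l: "(b * c * a - 1) * (b * a - scaleC z 1) = scaleC z 1" .
  have "invertible_elem (b * a - scaleC z 1)"
    by (rule invertible_elemI[of "scaleC (1/z) (b * c * a - 1)" _ "scaleC (1/z) (b * c * a - 1)"])
      (use l r \<open>z \<noteq> 0\<close> in \<open>simp_all add: scaleC_mult_left scaleC_mult_right scaleC_scaleC scaleC_one\<close>)
  with assms(1) show False by (simp add: spectrum_iff)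
qed

text \<open>For u = h + i v commutation gives \<open>adj u * u = h * h + v * v\<close>, and h is the
  real part of u, so its norm is at most that of u. This replaces monotonicity of the norm on
  positive elements before any order is available.\<close>

lemma norm_square_le_add_square:
  fixes h v :: "'a::cstar_algebra"
  assumes "adj h = h" "adj v = v" "h * v = v * h"
  shows "(norm h)\<^sup>2 \<le> norm (h * h + v * v)"
proof -
  let ?u = "h + scaleC \<i> v"
  have au: "adj ?u = h - scaleC \<i> v"
    by (simp add: adj_add adj_scaleC assms scaleC_minus_left)
  have "adj ?u * ?u = h * h + v * v"
    unfolding au
    by (simp add: algebra_simps scaleC_mult_left scaleC_mult_right scaleC_scaleC assms scaleC_minus_left scaleC_one
        scaleC_diff_right)
  then have n: "norm (h * h + v * v) = (norm ?u)\<^sup>2"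
    using cstar_identity[of ?u] by simp
  have "2 *\<^sub>R h = ?u + adj ?u"
    unfolding au by (simp add: scaleR_2)
  then have "2 * norm h = norm (?u + adj ?u)"
    by (metis norm_scaleR abs_numeral)
  also have "\<dots> \<le> 2 * norm ?u"
    using norm_triangle_ineq[of ?u "adj ?u"] by simp
  finally have "norm h \<le> norm ?u" by simp
  then show ?thesis unfolding n by (simp add: power_mono)
qed

text \<open>For the normalised k, the element 1 - k k is the square of a selfadjoint s commuting
  with k, and s s + k k = 1 bounds the norm of s s. In effect: squares are positive, in norm
  form.\<close>

lemma norm_diff_square_le:
  fixes h :: "'a::cstar_algebra"
  assumes h: "adj h = h"
  shows "norm (of_real ((norm h)\<^sup>2) - h * h) \<le> (norm h)\<^sup>2"
proof (cases "h = 0")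
  case False
  define m where "m = norm h"
  have m: "m > 0" using False by (simp add: m_def)
  define k where "k = (1/m) *\<^sub>R h"
  have k: "adj k = k" "norm k = 1" using m h by (auto simp: k_def adj_scaleR m_def)
  then have y: "norm (k * k) \<le> 1" using norm_square_selfadjoint[of k] by simp
  let ?s = "sqrt1m (k * k)"
  have s: "?s * ?s = 1 - k * k" by (rule sqrt1m_square[OF y])
  have sa: "adj ?s = ?s" by (rule adj_sqrt1m[OF y]) (simp add: adj_mult k)
  have c: "k * ?s = ?s * k" by (rule sqrt1m_commute[OF y]) (simp add: mult.assoc)
  have "(norm ?s)\<^sup>2 \<le> norm (?s * ?s + k * k)"
    by (rule norm_square_le_add_square) (use sa k c in auto)
  then have "norm (1 - k * k) \<le> 1"
    using norm_square_selfadjoint[OF sa] s by simp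
  moreover have "of_real (m\<^sup>2) - h * h = m\<^sup>2 *\<^sub>R (1 - k * k)"
    using m by (simp add: k_def algebra_simps of_real_def power2_eq_square)
  ultimately show ?thesis
    using m by (simp add: m_def[symmetric] mult_left_le)
qed simp

text \<open>Multiplying h - z = x - w, with w = i Im z, by the commuting x + w gives the square of x
  plus (Im z)^2. The extra (Im z)^2 makes the bound for squares strict, hence the product
  invertible.\<close>

lemma spectrum_selfadjoint_real:
  fixes h :: "'a::cstar_algebra"
  assumes h: "adj h = h" and z: "z \<in> spectrum h"
  shows "z = of_real (Re z)"
proof (rule ccontr)
  assume "\<not> ?thesis"
  then have b: "Im z \<noteq> 0" by (auto simp: complex_eq_iff)
  define x where "x = h - of_real (Re z)"
  define w where "w = scaleC (\<i> * Im z) (1::'a)"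
  have x: "adj x = x" by (simp add: x_def adj_diff h)
  have z': "scaleC z 1 = of_real (Re z) + w"
    by (subst complex_eq[of z]) (simp add: scaleC_add_left scaleC_of_real_one w_def)
  have cw: "w * a = a * w" for a :: 'a
    by (simp add: w_def scaleC_mult_left scaleC_mult_right)
  have "w * w = scaleC (of_real (- (Im z)\<^sup>2)) 1"
    by (simp add: w_def scaleC_mult_left scaleC_scaleC power2_eq_square algebra_simps)
  then have "w * w = of_real (- (Im z)\<^sup>2)"
    by (simp only: scaleC_of_real_one)
  then have ww: "w * w = - of_real ((Im z)\<^sup>2)"
    by (simp only: of_real_minus)
  have eq: "(x - w) * (x + w) = x * x + of_real ((Im z)\<^sup>2)"
    using ww cw[of x] by (simp add: algebra_simps)
  have "of_real ((norm x)\<^sup>2 + (Im z)\<^sup>2) - (x * x + of_real ((Im z)\<^sup>2)) = of_real ((norm x)\<^sup>2) - x * x"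
    by simp
  then have "norm (of_real ((norm x)\<^sup>2 + (Im z)\<^sup>2) - (x * x + of_real ((Im z)\<^sup>2))) \<le> (norm x)\<^sup>2"
    using norm_diff_square_le[OF x] by simp
  also have "\<dots> < (norm x)\<^sup>2 + (Im z)\<^sup>2" using b by simp
  finally have "invertible_elem ((x - w) * (x + w))"
    unfolding eq by (rule invertible_elem_near_of_real)
  then have "invertible_elem (x - w)"
    by (rule invertible_elem_commuting_factor) (use cw[of x] in \<open>simp add: algebra_simps\<close>)
  moreover have "x - w = h - scaleC z 1" by (simp add: x_def z')
  ultimately show False using z by (simp add: spectrum_iff)
qed

text \<open>If both signs failed, then \<open>1 - k\<^sup>2\<close> would be invertible for the normalised element \<open>k\<close>, hence
  bounded below, so \<open>k\<^sup>2 + v\<^sup>2 = 1 - 1/N\<close> for some \<open>v\<close> commuting with \<open>k\<close>, contradicting \<open>\<parallel>k\<parallel> = 1\<close>.\<close>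

lemma norm_in_spectrum:
  fixes h :: "'a::cstar_algebra"
  assumes h: "adj h = h"
  shows "of_real (norm h) \<in> spectrum h \<or> of_real (- norm h) \<in> spectrum h"
proof (rule ccontr)
  assume neg: "\<not> ?thesis"
  define m where "m = norm h"
  have inv: "invertible_elem (h - of_real m)" "invertible_elem (h + of_real m)"
    using neg by (simp_all only: spectrum_iff scaleC_of_real_one m_def) auto
  have "h \<noteq> 0"
  proof
    assume "h = 0"
    with inv(1) show False by (simp add: m_def invertible_elem_def)
  qed
  then have m: "m > 0" by (simp add: m_def)
  define k where "k = (1/m) *\<^sub>R h"
  have k: "adj k = k" "norm k = 1" using m h by (auto simp: k_def adj_scaleR m_def)
  then have y: "norm (k * k) \<le> 1" using norm_square_selfadjoint[of k] by simp
  define s where "s = sqrt1m (k * k)"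
  have s: "s * s = 1 - k * k" unfolding s_def by (rule sqrt1m_square[OF y])
  have sa: "adj s = s" unfolding s_def by (rule adj_sqrt1m[OF y]) (simp add: adj_mult k)
  have c: "k * s = s * k" unfolding s_def by (rule sqrt1m_commute[OF y]) (simp add: mult.assoc)
  have "invertible_elem (scaleC (of_real (- 1 / m\<^sup>2)) ((h - of_real m) * (h + of_real m)))"
    using m by (intro invertible_elem_scaleC invertible_elem_mult inv) auto
  moreover have "scaleC (of_real (- 1 / m\<^sup>2)) ((h - of_real m) * (h + of_real m)) = s * s"
    unfolding scaleC_of_real s using m by (simp add: k_def algebra_simps of_real_def power2_eq_square)
  ultimately have "invertible_elem s"
    by (metis invertible_elem_commuting_factor)
  then obtain z where z: "s * z = 1" "z * s = 1" by (auto simp: invertible_elem_def)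
  have za: "adj z = z"
  proof -
    have "adj z * s = 1" using arg_cong[OF z(1), of adj] by (simp add: adj_mult sa)
    then show ?thesis by (metis z(1) mult.assoc mult.left_neutral mult.right_neutral)
  qed
  have ck: "k * z = z * k"
  proof -
    have "z * (k * s) * z = z * (s * k) * z" by (simp add: c)
    then show ?thesis by (metis z mult.assoc mult.left_neutral mult.right_neutral)
  qed
  \<comment> \<open>N is the norm of z z, so z z / N lies in the unit ball and 1 - z z / N has a
    root w; then v = s w satisfies v v = s s - 1/N because s z = 1.\<close>
  define N where "N = (norm z)\<^sup>2"
  have "(norm s)\<^sup>2 \<le> norm (s * s + k * k)"
    by (rule norm_square_le_add_square) (use sa k c in auto)
  then have "norm s \<le> 1" using s by (simp add: power2_le_iff_abs_le abs_le_square_iff[of _ 1, simplified, symmetric])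
  moreover have "1 \<le> norm s * norm z" using norm_mult_ineq[of s z] z by simp
  ultimately have "1 \<le> norm z"
    by (smt (verit) mult_left_le_one_le norm_ge_zero)
  then have N: "N \<ge> 1" by (simp add: N_def)
  define y' where "y' = (1/N) *\<^sub>R (z * z)"
  have y': "norm y' \<le> 1" using N norm_square_selfadjoint[OF za] by (simp add: y'_def N_def)
  define w where "w = sqrt1m y'"
  have w: "w * w = 1 - y'" unfolding w_def by (rule sqrt1m_square[OF y'])
  have wa: "adj w = w" unfolding w_def by (rule adj_sqrt1m[OF y']) (simp add: y'_def adj_scaleR adj_mult za)
  have cs: "s * w = w * s" unfolding w_def
    by (rule sqrt1m_commute[OF y']) (simp add: y'_def mult.assoc z, simp add: mult.assoc[symmetric] z)
  have "k * (z * z) = z * z * k" by (metis ck mult.assoc)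
  then have cw: "k * w = w * k"
    unfolding w_def by (intro sqrt1m_commute[OF y']) (simp add: y'_def)
  define v where "v = s * w"
  have va: "adj v = v" by (simp add: v_def adj_mult sa wa cs)
  have "v * v = s * (w * s) * w" by (simp add: v_def mult.assoc)
  also have "\<dots> = (s * s) * (w * w)" by (simp add: cs[symmetric] mult.assoc)
  also have "\<dots> = s * s - (1/N) *\<^sub>R (s * (s * z) * z)"
    by (simp add: w y'_def algebra_simps)
  also have "\<dots> = s * s - of_real (1/N)" by (simp add: z of_real_def)
  finally have vv: "k * k + v * v = of_real (1 - 1/N)" by (simp add: s)
  have kv: "k * v = v * k"
    by (simp add: v_def mult.assoc cw[symmetric], simp add: mult.assoc[symmetric] c)
  have "(norm k)\<^sup>2 \<le> norm (of_real (1 - 1/N) :: 'a)"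
    using norm_square_le_add_square[OF k(1) va kv] unfolding vv .
  also have "\<dots> = 1 - 1/N" using N by (subst norm_of_real) simp
  finally show False using k N by simp
qed

section \<open>The positive cone, its order and its square roots\<close>

text \<open>For a negative real z, a - z lies in the open ball of radius t - z about t - z and is
  invertible. Stated as a norm inequality, positivity passes to sums by the triangle inequality, for
  which the spectral definition offers no handle.\<close>

lemma positive_elemI:
  fixes a :: "'a::cstar_algebra"
  assumes a: "adj a = a" and t: "norm (of_real t - a) \<le> t"
  shows "positive_elem a"
  unfolding positive_elem_def selfadjoint_def
proof (intro conjI subsetI a)
  fix z assume z: "z \<in> spectrum a"
  have zr: "z = of_real (Re z)" by (rule spectrum_selfadjoint_real[OF a z])
  have "Re z \<ge> 0"
  proof (rule ccontr)
    assume "\<not> Re z \<ge> 0"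
    then have r: "Re z < 0" by simp
    have "of_real (t - Re z) - (a - scaleC z 1) = of_real t - a"
      by (subst (2) zr) (simp add: scaleC_of_real_one)
    then have "invertible_elem (a - scaleC z 1)"
      by (intro invertible_elem_near_of_real[of "t - Re z"]) (use t r in simp)
    then show False using z by (simp add: spectrum_iff)
  qed
  then show "z \<in> complex_of_real ` {0..}" using zr by blast
qed

lemma spectrum_of_real_minus:
  "z \<in> spectrum (of_real t - a) \<Longrightarrow> of_real t - z \<in> spectrum (a::'a::cstar_algebra)"
proof -
  have "scaleC (- 1) (a - scaleC (of_real t - z) 1) = of_real t - a - scaleC z 1"
    by (simp add: scaleC_minus_left scaleC_one scaleC_diff_left scaleC_of_real_one)
  then show "z \<in> spectrum (of_real t - a) \<Longrightarrow> of_real t - z \<in> spectrum a"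
    using invertible_elem_scaleC[of "a - scaleC (of_real t - z) 1" "- 1"]
    by (auto simp: spectrum_iff)
qed

text \<open>The spectrum of norm a - a is that of a reflected, so it lies between 0 and norm a; the
  norm of a selfadjoint element is attained on its spectrum.\<close>

lemma positive_elemD:
  fixes a :: "'a::cstar_algebra"
  assumes "positive_elem a"
  shows "adj a = a" "norm (of_real (norm a) - a) \<le> norm a"
proof -
  show a: "adj a = a" using assms by (simp add: positive_elem_def selfadjoint_def)
  define h where "h = of_real (norm a) - a"
  have h: "adj h = h" by (simp add: h_def adj_diff a)
  have sp: "of_real (norm a) - z \<in> complex_of_real ` {0..} \<and> cmod (of_real (norm a) - z) \<le> norm a" if "z \<in> spectrum h" for z
    using spectrum_of_real_minus[OF that[unfolded h_def]] assms norm_spectrum_le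
    unfolding positive_elem_def by blast
  from norm_in_spectrum[OF h] have "norm h \<le> norm a"
  proof
    assume "of_real (norm h) \<in> spectrum h"
    from sp[OF this] obtain r where "r \<ge> 0" "complex_of_real (norm a - norm h) = of_real r" by auto
    then show ?thesis by (simp only: of_real_eq_iff)
  next
    assume "of_real (- norm h) \<in> spectrum h"
    from sp[OF this] have "cmod (of_real (norm a + norm h)) \<le> norm a" by simp
    then show ?thesis by (simp only: norm_of_real)
  qed
  then show "norm (of_real (norm a) - a) \<le> norm a" by (simp add: h_def)
qed

lemma positive_elem_zero [simp]: "positive_elem (0::'a::cstar_algebra)"
  by (rule positive_elemI[of _ 0]) auto

lemma positive_elem_of_real: "t \<ge> 0 \<Longrightarrow> positive_elem (of_real t :: 'a::cstar_algebra)"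
  by (rule positive_elemI[of _ t]) auto

lemma positive_elem_add:
  fixes a b :: "'a::cstar_algebra"
  assumes "positive_elem a" "positive_elem b"
  shows "positive_elem (a + b)"
proof (rule positive_elemI)
  show "adj (a + b) = a + b" using assms by (simp add: adj_add positive_elemD)
  have eq: "of_real (norm a + norm b) - (a + b) = (of_real (norm a) - a) + (of_real (norm b) - b)"
    by simp
  show "norm (of_real (norm a + norm b) - (a + b)) \<le> norm a + norm b"
    unfolding eq using norm_triangle_ineq[of "of_real (norm a) - a" "of_real (norm b) - b"]
      positive_elemD(2)[OF assms(1)] positive_elemD(2)[OF assms(2)] by linarith
qed

lemma positive_elem_scaleR:
  fixes a :: "'a::cstar_algebra"
  assumes "positive_elem a" "r \<ge> 0"
  shows "positive_elem (r *\<^sub>R a)"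
proof (rule positive_elemI)
  show "adj (r *\<^sub>R a) = r *\<^sub>R a" using assms by (simp add: adj_scaleR positive_elemD)
  have "of_real (r * norm a) - r *\<^sub>R a = r *\<^sub>R (of_real (norm a) - a)"
    by (simp add: of_real_def algebra_simps)
  then show "norm (of_real (r * norm a) - r *\<^sub>R a) \<le> r * norm a"
    using positive_elemD(2)[OF assms(1)] assms(2) by (simp add: mult_left_mono)
qed

lemma positive_elem_square:
  "adj h = h \<Longrightarrow> positive_elem (h * h :: 'a::cstar_algebra)"
  by (rule positive_elemI[OF _ norm_diff_square_le]) (simp_all add: adj_mult)

lemma positive_elem_of_real_minus:
  fixes h :: "'a::cstar_algebra"
  assumes "adj h = h" "norm h \<le> t"
  shows "positive_elem (of_real t - h)"
  by (rule positive_elemI[of _ t]) (use assms in \<open>auto simp: adj_diff\<close>)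

text \<open>With t = norm a, the element y = 1 - a / t lies in the unit ball, so the binomial series
  applies. Being a series in a, the root commutes with everything that commutes with a; this clause
  is what later makes the absolute value of h commute with h.\<close>

lemma positive_elem_sqrt:
  fixes a :: "'a::cstar_algebra"
  assumes "positive_elem a"
  obtains s where "positive_elem s" "adj s = s" "s * s = a" "\<And>x. x * a = a * x \<Longrightarrow> x * s = s * x"
proof (cases "a = 0")
  case True
  then show ?thesis by (intro that[of 0]) auto
next
  case False
  define t where "t = norm a"
  have t: "t > 0" "norm (of_real t - a) \<le> t" "adj a = a"
    using False positive_elemD[OF assms] by (auto simp: t_def)
  define y where "y = (1/t) *\<^sub>R (of_real t - a)"
  have y: "norm y \<le> 1" "adj y = y" using t by (auto simp: y_def adj_scaleR adj_diff)
  define s where "s = sqrt t *\<^sub>R sqrt1m y"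
  show ?thesis
  proof (rule that)
    show sa: "adj s = s" by (simp add: s_def adj_scaleR adj_sqrt1m y)
    have "s * s = (sqrt t * sqrt t) *\<^sub>R (sqrt1m y * sqrt1m y)" by (simp add: s_def)
    also have "\<dots> = t *\<^sub>R (1 - y)" using t by (simp add: sqrt1m_square y)
    also have "\<dots> = a" using t by (simp add: y_def algebra_simps of_real_def)
    finally show "s * s = a" .
    have "of_real (sqrt t) - s = sqrt t *\<^sub>R (1 - sqrt1m y)"
      by (simp add: s_def of_real_def algebra_simps)
    then have "norm (of_real (sqrt t) - s) \<le> sqrt t"
      using norm_one_minus_sqrt1m[OF y(1)] t by (simp add: mult_left_le)
    then show "positive_elem s" by (rule positive_elemI[OF sa])
    fix x assume "x * a = a * x"
    then have "x * y = y * x" by (simp add: y_def algebra_simps of_real_def)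
    then show "x * s = s * x" by (simp add: s_def sqrt1m_commute[OF y(1)])
  qed
qed

text \<open>The roots s of a and r of -a commute, so the norm of s is controlled by s s + r r =
  0.\<close>

lemma positive_elem_antisym:
  fixes a :: "'a::cstar_algebra"
  assumes "positive_elem a" "positive_elem (- a)"
  shows "a = 0"
proof -
  obtain s where s: "adj s = s" "s * s = a" "\<And>x. x * a = a * x \<Longrightarrow> x * s = s * x"
    using positive_elem_sqrt[OF assms(1)] by metis
  obtain r where r: "adj r = r" "r * r = - a" "\<And>x. x * (- a) = (- a) * x \<Longrightarrow> x * r = r * x"
    using positive_elem_sqrt[OF assms(2)] by metis
  have "s * a = a * s" by (simp add: s(2)[symmetric] mult.assoc)
  then have "s * r = r * s" using r(3)[of s] by simp
  then have "(norm s)\<^sup>2 \<le> norm (s * s + r * r)"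
    by (rule norm_square_le_add_square[OF s(1) r(1)])
  then have "s = 0" by (simp add: s r)
  then show ?thesis using s by simp
qed

text \<open>The element \<open>n = \<bar>h\<bar> - h\<close> is twice the negative part of \<open>h\<close>, and \<open>k = \<bar>h\<bar>\<^sup>1\<^sup>/\<^sup>2 n\<close>.\<close>

lemma negative_part:
  fixes h :: "'a::cstar_algebra"
  assumes h: "adj h = h"
  obtains n k where "adj n = n" "adj k = k" "n * h * n = - (k * k)" "k * k = 0 \<Longrightarrow> positive_elem h"
proof -
  obtain m where m: "positive_elem m" "adj m = m" "m * m = h * h"
    "\<And>z. z * (h * h) = (h * h) * z \<Longrightarrow> z * m = m * z"
    using positive_elem_sqrt[OF positive_elem_square[OF h]] by metis
  have hm: "h * m = m * h" by (rule m(4)) (simp add: mult.assoc)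
  obtain e where e: "adj e = e" "e * e = m" "\<And>z. z * m = m * z \<Longrightarrow> z * e = e * z"
    using positive_elem_sqrt[OF m(1)] by metis
  have he: "h * e = e * h" using e(3) hm by blast
  define n where "n = m - h"
  have n: "adj n = n" by (simp add: n_def adj_diff h m)
  have en: "e * n = n * e"
    by (simp add: n_def algebra_simps he) (metis e(2) mult.assoc)
  have hn: "h * n = - (m * n)" by (simp add: n_def algebra_simps hm m)
  define k where "k = e * n"
  show ?thesis
  proof (rule that[of n k])
    show "adj n = n" by (rule n)
    show ka: "adj k = k" by (simp add: k_def adj_mult e n en)
    have "n * h * n = - (n * e * (e * n))" by (simp add: hn e(2)[symmetric] mult.assoc)
    then show "n * h * n = - (k * k)" by (simp add: k_def en)
    assume "k * k = 0"
    then have "e * n = 0" using adj_mult_self_eq_0[of k] ka by (simp add: k_def)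
    then have mn: "m * n = 0" by (simp add: e(2)[symmetric] mult.assoc)
    have "n * n = m * n - h * n" by (simp add: n_def algebra_simps)
    also have "\<dots> = 0" by (simp add: hn mn)
    finally have "n = 0" using adj_mult_self_eq_0[of n] n by simp
    then show "positive_elem h" using m(1) by (simp add: n_def)
  qed
qed

text \<open>For \<open>h = x\<^sup>* x\<close> and \<open>n\<close> as above, the element \<open>y = x n\<close> satisfies \<open>y\<^sup>* y \<le> 0\<close>, while
  \<open>y y\<^sup>* + y\<^sup>* y\<close> is a sum of squares; since the two products share their nonzero spectrum, \<open>y = 0\<close>.\<close>

lemma positive_elem_adj_mult_self: "positive_elem (adj x * (x::'a::cstar_algebra))"
proof -
  define h where "h = adj x * x"
  have h: "adj h = h" by (simp add: h_def adj_mult adj_adj)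
  obtain n k where n: "adj n = n" and k: "adj k = k" and nhn: "n * h * n = - (k * k)"
    and h_pos: "k * k = 0 \<Longrightarrow> positive_elem h"
    by (rule negative_part[OF h]) blast
  define y where "y = x * n"
  have yy: "adj y * y = - (k * k)"
    using nhn by (simp add: y_def adj_mult n h_def mult.assoc)
  have neg: "positive_elem (- (adj y * y))"
    using positive_elem_square[OF k] by (simp add: yy)
  define u where "u = (1/2) *\<^sub>R (y + adj y)"
  define v where "v = scaleC (- \<i> / 2) (y - adj y)"
  have ua: "adj u = u" by (simp add: u_def adj_scaleR adj_add adj_adj add.commute)
  have va: "adj v = v"
    by (simp add: v_def adj_scaleC adj_diff adj_adj scaleC_diff_right scaleC_minus_left)
  have "y * adj y + adj y * y = 2 *\<^sub>R (u * u + v * v)"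
    unfolding u_def v_def scaleR_scaleC
    by (simp add: scaleC_mult_left scaleC_mult_right scaleC_scaleC algebra_simps scaleC_add_right
        scaleC_diff_right scaleC_minus_left scaleC_one)
      (simp add: scaleC_one flip: scaleC_add_left add.assoc)
  then have "y * adj y = 2 *\<^sub>R (u * u + v * v) + (- (adj y * y))"
    by (simp add: algebra_simps)
  then have posr: "positive_elem (y * adj y)"
    using neg positive_elem_square[OF ua] positive_elem_square[OF va]
    by (metis positive_elem_add positive_elem_scaleR zero_le_numeral)
  have "positive_elem (adj y * y)"
    unfolding positive_elem_def selfadjoint_def
  proof (intro conjI subsetI)
    show "adj (adj y * y) = adj y * y" by (simp add: adj_mult adj_adj)
    fix z assume z: "z \<in> spectrum (adj y * y)"
    show "z \<in> complex_of_real ` {0..}"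
    proof (cases "z = 0")
      case False
      from spectrum_mult_commute[OF z False] posr show ?thesis by (auto simp: positive_elem_def)
    qed auto
  qed
  from positive_elem_antisym[OF this neg] have "k * k = 0" by (simp add: yy)
  then show ?thesis using h_pos by (simp add: h_def)
qed

lemma positive_elem_mult_adj: "positive_elem (x * adj (x::'a::cstar_algebra))"
  using positive_elem_adj_mult_self[of "adj x"] by (simp add: adj_adj)

lemma positive_elem_conj:
  fixes a x :: "'a::cstar_algebra"
  assumes "positive_elem a"
  shows "positive_elem (adj x * a * x)"
proof -
  obtain s where s: "adj s = s" "s * s = a" using positive_elem_sqrt[OF assms] by metis
  have "adj x * a * x = adj (s * x) * (s * x)"
    by (simp add: adj_mult s(1) s(2)[symmetric] mult.assoc)
  then show ?thesis using positive_elem_adj_mult_self by metis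
qed

subsection \<open>Continuous functional calculus\<close>

text \<open>Complex coefficients are used so that a polynomial splits into linear factors; real
  polynomials are embedded through \<open>map_poly of_real\<close>.\<close>

definition cpoly_eval :: "complex poly \<Rightarrow> 'a::cstar_algebra \<Rightarrow> 'a" where
  "cpoly_eval p x = (\<Sum>i\<le>degree p. scaleC (coeff p i) (x ^ i))"

lemma cpoly_eval_upto:
  "degree p \<le> n \<Longrightarrow> cpoly_eval p x = (\<Sum>i\<le>n. scaleC (coeff p i) (x ^ i))"
  unfolding cpoly_eval_def by (rule sum.mono_neutral_left) (auto simp: coeff_eq_0)

lemma cpoly_eval_0 [simp]: "cpoly_eval 0 x = 0"
  by (simp add: cpoly_eval_def)

lemma cpoly_eval_pCons [simp]: "cpoly_eval (pCons c p) x = scaleC c 1 + x * cpoly_eval p x"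
proof -
  have "cpoly_eval (pCons c p) x = (\<Sum>i\<le>Suc (degree p). scaleC (coeff (pCons c p) i) (x ^ i))"
    by (rule cpoly_eval_upto) (simp add: degree_pCons_le)
  also have "\<dots> = scaleC c 1 + (\<Sum>i\<le>degree p. scaleC (coeff p i) (x ^ Suc i))"
    by (subst sum.atMost_Suc_shift) simp
  also have "(\<Sum>i\<le>degree p. scaleC (coeff p i) (x ^ Suc i)) = x * cpoly_eval p x"
    by (simp add: cpoly_eval_def sum_distrib_left scaleC_mult_right)
  finally show ?thesis .
qed

lemma cpoly_eval_add: "cpoly_eval (p + q) x = cpoly_eval p x + cpoly_eval q x"
  by (induction p q rule: poly_induct2) (simp_all add: scaleC_add_left algebra_simps)

lemma cpoly_eval_smult: "cpoly_eval (smult c p) x = scaleC c (cpoly_eval p x)"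
  by (induction p) (simp_all add: scaleC_add_right scaleC_scaleC scaleC_mult_right)

lemma cpoly_eval_diff: "cpoly_eval (p - q) x = cpoly_eval p x - cpoly_eval q x"
  using cpoly_eval_add[of "p - q" q x] by simp

lemma cpoly_eval_mult: "cpoly_eval (p * q) x = cpoly_eval p x * cpoly_eval q x"
  by (induction p)
    (simp_all add: cpoly_eval_add cpoly_eval_smult scaleC_mult_left algebra_simps)

text \<open>The fundamental theorem of algebra splits off factors x - w with w outside the spectrum,
  each invertible; the constant left over is nonzero.\<close>

lemma invertible_cpoly_eval:
  fixes x :: "'a::cstar_algebra"
  assumes "q \<noteq> 0" "\<And>w. poly q w = 0 \<Longrightarrow> w \<notin> spectrum x"
  shows "invertible_elem (cpoly_eval q x)"
  using assms
proof (induction "degree q" arbitrary: q)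
  case 0
  then obtain c where "q = [:c:]" using degree_eq_zeroE by metis
  with 0 have "c \<noteq> 0" "cpoly_eval q x = scaleC c 1" by auto
  moreover have "invertible_elem (1::'a)" by (rule invertible_elemI[of 1 _ 1]) auto
  ultimately show ?case
    by (simp add: invertible_elem_scaleC)
next
  case (Suc n)
  have "\<not> constant (poly q)" using Suc(2) by (simp add: constant_degree)
  then obtain w where w: "poly q w = 0" using fundamental_theorem_of_algebra by blast
  then obtain q' where q': "q = [:- w, 1:] * q'" by (auto simp: poly_eq_0_iff_dvd)
  have "q' \<noteq> 0" using q' Suc.prems(1) by auto
  then have "degree q = Suc (degree q')" unfolding q' by (subst degree_mult_eq) auto
  then have "n = degree q'" using Suc(2) by simp
  then have "invertible_elem (cpoly_eval q' x)"
    using Suc.prems(2) \<open>q' \<noteq> 0\<close> by (intro Suc(1)) (auto simp: q')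
  moreover have "cpoly_eval [:- w, 1:] x = x - scaleC w 1"
    by (simp add: scaleC_minus_left scaleC_one)
  then have "invertible_elem (cpoly_eval [:- w, 1:] x)"
    using Suc.prems(2)[OF w] by (simp add: spectrum_iff)
  ultimately show ?case unfolding q' cpoly_eval_mult by (intro invertible_elem_mult)
qed

lemma spectrum_cpoly_eval:
  fixes x :: "'a::cstar_algebra"
  assumes x: "adj x = x" and z: "z \<in> spectrum (cpoly_eval p x)"
  obtains w where "w \<in> spectrum x" "poly p w = z"
proof (cases "p = [:z:]")
  case True
  \<comment> \<open>Here p - z vanishes identically, so any spectral point will do; that the
    spectrum is nonempty follows from the norm being attained on it.\<close>
  obtain w where "w \<in> spectrum x" using norm_in_spectrum[OF x] by blast
  then show ?thesis using True that by simp
next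
  case False
  have "cpoly_eval (p - [:z:]) x = cpoly_eval p x - scaleC z 1"
    by (simp add: cpoly_eval_diff)
  then have "\<not> invertible_elem (cpoly_eval (p - [:z:]) x)"
    using z by (simp add: spectrum_iff)
  then obtain w where "w \<in> spectrum x" "poly (p - [:z:]) w = 0"
    using invertible_cpoly_eval[of "p - [:z:]" x] False by auto
  then show ?thesis using that by simp
qed

lemma poly_eval_eq_cpoly_eval: "poly_eval p x = cpoly_eval (map_poly of_real p) x"
  by (simp add: poly_eval_def cpoly_eval_def coeff_map_poly degree_map_poly)

lemma poly_map_poly_of_real: "poly (map_poly of_real p) (complex_of_real t) = of_real (poly p t)"
  by (induction p) (simp_all add: map_poly_pCons)

lemma map_poly_of_real_add: "map_poly of_real (p + q) = map_poly complex_of_real p + map_poly of_real q"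
  by (intro poly_eqI) (simp add: coeff_map_poly)

lemma map_poly_of_real_mult: "map_poly of_real (p * q) = map_poly complex_of_real p * map_poly of_real q"
  by (intro poly_eqI) (simp add: coeff_map_poly coeff_mult)

lemma poly_eval_add: "poly_eval (p + q) x = poly_eval p x + poly_eval q x"
  by (simp add: poly_eval_eq_cpoly_eval map_poly_of_real_add cpoly_eval_add)

lemma poly_eval_mult: "poly_eval (p * q) x = poly_eval p x * poly_eval q x"
  by (simp add: poly_eval_eq_cpoly_eval map_poly_of_real_mult cpoly_eval_mult)

lemma poly_eval_const: "poly_eval [:c:] x = of_real c"
  by (simp add: poly_eval_eq_cpoly_eval map_poly_pCons scaleC_of_real_one)

lemma poly_eval_diff: "poly_eval (p - q) x = poly_eval p x - poly_eval q x"
  by (metis add_diff_cancel_right' diff_add_cancel poly_eval_add)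

lemma adj_poly_eval: "adj x = x \<Longrightarrow> adj (poly_eval p x) = poly_eval p (x::'a::cstar_algebra)"
  by (simp add: poly_eval_def adj_sum adj_scaleC adj_power)

text \<open>The norm is attained at a spectral point of the selfadjoint
  \<open>poly_eval p x\<close>, and by spectral mapping that point is a value of p on the real
  spectrum of x. This estimate is what makes uniform limits of polynomials converge in norm.\<close>

lemma norm_poly_eval_le:
  fixes x :: "'a::cstar_algebra"
  assumes x: "adj x = x" and e: "\<And>t. t \<in> Re ` spectrum x \<Longrightarrow> \<bar>poly p t\<bar> \<le> e"
  shows "norm (poly_eval p x) \<le> e"
proof -
  obtain z where z: "z \<in> spectrum (poly_eval p x)" "cmod z = norm (poly_eval p x)"
    using norm_in_spectrum[OF adj_poly_eval[OF x, of p]] by (metis norm_of_real abs_norm_cancel abs_minus_cancel)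
  then obtain w where w: "w \<in> spectrum x" "poly (map_poly of_real p) w = z"
    using spectrum_cpoly_eval[OF x, of z "map_poly of_real p"] by (auto simp: poly_eval_eq_cpoly_eval)
  have "w = of_real (Re w)" by (rule spectrum_selfadjoint_real[OF x w(1)])
  then have "z = of_real (poly p (Re w))" using w(2) poly_map_poly_of_real by metis
  then have "norm (poly_eval p x) = \<bar>poly p (Re w)\<bar>" using z(2) by (metis norm_of_real real_norm_def)
  then show ?thesis using e w(1) by auto
qed

lemma compact_Re_spectrum: "compact (Re ` spectrum (x::'a::cstar_algebra))"
proof -
  have "bounded (spectrum x)"
    unfolding bounded_iff using norm_spectrum_le by blast
  then have "compact (spectrum x)"
    using closed_spectrum compact_eq_bounded_closed by blast
  then show ?thesis
    by (intro compact_continuous_image continuous_intros)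
qed

lemma polynomial_uniform_approximation:
  fixes F :: "real \<Rightarrow> real"
  assumes "compact K" "continuous_on K F"
  obtains p :: "nat \<Rightarrow> real poly" where "uniform_limit K (\<lambda>n t. poly (p n) t) F sequentially"
proof -
  have "\<exists>p::real poly. \<forall>t\<in>K. \<bar>F t - poly p t\<bar> < 1 / Suc n" for n
  proof -
    obtain h where h: "real_polynomial_function h" "\<And>t. t \<in> K \<Longrightarrow> \<bar>F t - h t\<bar> < 1 / Suc n"
      using Stone_Weierstrass_real_polynomial_function[OF assms, of "1 / Suc n"] by auto
    then obtain a m where "h = (\<lambda>t. \<Sum>i\<le>m. a i * t ^ i)"
      by (auto simp: real_polynomial_function_iff_sum)
    then have "h t = poly (\<Sum>i\<le>m. monom (a i) i) t" for t
      by (simp add: poly_sum poly_monom)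
    then show ?thesis using h(2) by metis
  qed
  then obtain p :: "nat \<Rightarrow> real poly" where p: "\<And>n t. t \<in> K \<Longrightarrow> \<bar>F t - poly (p n) t\<bar> < 1 / Suc n"
    by metis
  have "uniform_limit K (\<lambda>n t. poly (p n) t) F sequentially"
  proof (rule uniform_limitI)
    fix e :: real assume "e > 0"
    then obtain N where N: "inverse (real (Suc N)) < e" using reals_Archimedean by blast
    show "\<forall>\<^sub>F n in sequentially. \<forall>t\<in>K. dist (poly (p n) t) (F t) < e"
    proof (rule eventually_sequentiallyI[of N], intro ballI)
      fix n t assume "N \<le> n" "t \<in> K"
      then have "\<bar>F t - poly (p n) t\<bar> < 1 / Suc n" "1 / real (Suc n) \<le> 1 / real (Suc N)"
        using p by (auto simp: frac_le)
      then show "dist (poly (p n) t) (F t) < e"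
        using N by (simp add: dist_real_def abs_minus_commute inverse_eq_divide)
    qed
  qed
  then show ?thesis by (rule that)
qed

section \<open>From polynomials to continuous functions\<close>

context
  fixes x :: "'a::cstar_algebra"
  assumes x: "adj x = x"
begin

lemma cfc_limit_ex:
  assumes F: "continuous_on (Re ` spectrum x) F"
  shows "\<exists>y. \<forall>p. uniform_limit (Re ` spectrum x) (\<lambda>n t. poly (p n) t) F sequentially
      \<longrightarrow> (\<lambda>n. poly_eval (p n) x) \<longlonglongrightarrow> y"
proof -
  let ?K = "Re ` spectrum x"
  obtain p0 where p0: "uniform_limit ?K (\<lambda>n t. poly (p0 n) t) F sequentially"
    by (rule polynomial_uniform_approximation[OF compact_Re_spectrum F])
  \<comment> \<open>Used twice: with q = p it makes one reference sequence Cauchy, and with two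
    different sequences it shows that all of them share the same limit.\<close>
  have close: "\<exists>N. \<forall>m\<ge>N. \<forall>n\<ge>N. norm (poly_eval (p m) x - poly_eval (q n) x) < e"
    if lim: "uniform_limit ?K (\<lambda>n t. poly (p n) t) F sequentially"
      "uniform_limit ?K (\<lambda>n t. poly (q n) t) F sequentially" and e: "e > 0" for p q and e :: real
  proof -
    have e3: "e / 3 > 0" using e by simp
    obtain M where M: "\<forall>m\<ge>M. \<forall>t\<in>?K. dist (poly (p m) t) (F t) < e / 3"
      using uniform_limitD[OF lim(1) e3] unfolding eventually_sequentially by blast
    obtain N where N: "\<forall>n\<ge>N. \<forall>t\<in>?K. dist (poly (q n) t) (F t) < e / 3"
      using uniform_limitD[OF lim(2) e3] unfolding eventually_sequentially by blast
    have "norm (poly_eval (p m) x - poly_eval (q n) x) < e" if "m \<ge> max M N" "n \<ge> max M N" for m n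
    proof -
      have "norm (poly_eval (p m - q n) x) \<le> 2 * e / 3"
      proof (rule norm_poly_eval_le[OF x])
        fix t assume t: "t \<in> ?K"
        have "dist (poly (p m) t) (F t) < e / 3" "dist (poly (q n) t) (F t) < e / 3"
          using M N t that by (meson max.bounded_iff)+
        then have "\<bar>poly (p m) t - F t\<bar> < e / 3" "\<bar>poly (q n) t - F t\<bar> < e / 3"
          by (auto simp: dist_real_def)
        then show "\<bar>poly (p m - q n) t\<bar> \<le> 2 * e / 3" unfolding poly_diff by linarith
      qed
      then show ?thesis using \<open>e > 0\<close> by (simp add: poly_eval_diff)
    qed
    then show ?thesis by blast
  qed
  have "Cauchy (\<lambda>n. poly_eval (p0 n) x)"
    unfolding Cauchy_def dist_norm using close[OF p0 p0] by blast
  then obtain y where y: "(\<lambda>n. poly_eval (p0 n) x) \<longlonglongrightarrow> y"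
    using Cauchy_convergent_iff convergent_def by blast
  have "(\<lambda>n. poly_eval (p n) x) \<longlonglongrightarrow> y"
    if p: "uniform_limit ?K (\<lambda>n t. poly (p n) t) F sequentially" for p
  proof -
    have "(\<lambda>n. poly_eval (p n) x - poly_eval (p0 n) x) \<longlonglongrightarrow> 0"
      unfolding LIMSEQ_iff using close[OF p p0] by (metis diff_zero)
    from tendsto_add[OF this y] show ?thesis by simp
  qed
  then show ?thesis by blast
qed

lemma cfc_limit:
  assumes F: "continuous_on (Re ` spectrum x) F"
    and p: "uniform_limit (Re ` spectrum x) (\<lambda>n t. poly (p n) t) F sequentially"
  shows "(\<lambda>n. poly_eval (p n) x) \<longlonglongrightarrow> cfc F x"
proof -
  let ?P = "\<lambda>y. \<forall>p. uniform_limit (Re ` spectrum x) (\<lambda>n t. poly (p n) t) F sequentially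
      \<longrightarrow> (\<lambda>n. poly_eval (p n) x) \<longlonglongrightarrow> y"
  obtain y where y: "?P y" using cfc_limit_ex[OF F] by blast
  have "?P (cfc F x)"
    unfolding cfc_def
  proof (rule theI[of ?P, OF y])
    fix z assume "?P z"
    \<comment> \<open>Uniqueness needs an approximating sequence, since otherwise every z would
      qualify vacuously; the given p is one.\<close>
    then show "z = y" using y p LIMSEQ_unique by blast
  qed
  then show ?thesis using p by blast
qed

lemma cfc_approx:
  assumes F: "continuous_on (Re ` spectrum x) F"
  obtains p where "uniform_limit (Re ` spectrum x) (\<lambda>n t. poly (p n) t) F sequentially"
    "(\<lambda>n. poly_eval (p n) x) \<longlonglongrightarrow> cfc F x"
  using polynomial_uniform_approximation[OF compact_Re_spectrum F] cfc_limit[OF F] by metis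

lemma adj_cfc:
  assumes F: "continuous_on (Re ` spectrum x) F"
  shows "adj (cfc F x) = cfc F x"
proof -
  obtain p where p: "(\<lambda>n. poly_eval (p n) x) \<longlonglongrightarrow> cfc F x"
    using cfc_approx[OF F] by metis
  have "(\<lambda>n. poly_eval (p n) x) \<longlonglongrightarrow> adj (cfc F x)"
    using bounded_linear.tendsto[OF bounded_linear_adj p] by (simp add: adj_poly_eval[OF x])
  then show ?thesis using p by (rule LIMSEQ_unique)
qed

lemma cfc_add:
  assumes F: "continuous_on (Re ` spectrum x) F" and G: "continuous_on (Re ` spectrum x) G"
  shows "cfc (\<lambda>t. F t + G t) x = cfc F x + cfc G x"
proof -
  obtain p where p: "uniform_limit (Re ` spectrum x) (\<lambda>n t. poly (p n) t) F sequentially"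
    "(\<lambda>n. poly_eval (p n) x) \<longlonglongrightarrow> cfc F x" by (rule cfc_approx[OF F])
  obtain q where q: "uniform_limit (Re ` spectrum x) (\<lambda>n t. poly (q n) t) G sequentially"
    "(\<lambda>n. poly_eval (q n) x) \<longlonglongrightarrow> cfc G x" by (rule cfc_approx[OF G])
  have "(\<lambda>n. poly_eval (p n + q n) x) \<longlonglongrightarrow> cfc (\<lambda>t. F t + G t) x"
    using uniform_limit_add[OF p(1) q(1)]
    by (intro cfc_limit continuous_on_add F G) simp
  moreover have "(\<lambda>n. poly_eval (p n + q n) x) \<longlonglongrightarrow> cfc F x + cfc G x"
    unfolding poly_eval_add by (rule tendsto_add[OF p(2) q(2)])
  ultimately show ?thesis by (rule LIMSEQ_unique)
qed

lemma cfc_mult: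
  assumes F: "continuous_on (Re ` spectrum x) F" and G: "continuous_on (Re ` spectrum x) G"
  shows "cfc (\<lambda>t. F t * G t) x = cfc F x * cfc G x"
proof -
  have b: "bounded (F ` Re ` spectrum x)" "bounded (G ` Re ` spectrum x)"
    using F G by (auto intro!: compact_imp_bounded compact_continuous_image compact_Re_spectrum)
  obtain p where p: "uniform_limit (Re ` spectrum x) (\<lambda>n t. poly (p n) t) F sequentially"
    "(\<lambda>n. poly_eval (p n) x) \<longlonglongrightarrow> cfc F x" by (rule cfc_approx[OF F])
  obtain q where q: "uniform_limit (Re ` spectrum x) (\<lambda>n t. poly (q n) t) G sequentially"
    "(\<lambda>n. poly_eval (q n) x) \<longlonglongrightarrow> cfc G x" by (rule cfc_approx[OF G])
  have "(\<lambda>n. poly_eval (p n * q n) x) \<longlonglongrightarrow> cfc (\<lambda>t. F t * G t) x"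
    using uniform_lim_mult[OF p(1) q(1) b]
    by (intro cfc_limit continuous_on_mult F G) simp
  moreover have "(\<lambda>n. poly_eval (p n * q n) x) \<longlonglongrightarrow> cfc F x * cfc G x"
    unfolding poly_eval_mult by (rule tendsto_mult[OF p(2) q(2)])
  ultimately show ?thesis by (rule LIMSEQ_unique)
qed

lemma cfc_const: "cfc (\<lambda>_. c) x = of_real c"
proof -
  have "(\<lambda>n::nat. poly_eval [:c:] x) \<longlonglongrightarrow> cfc (\<lambda>_. c) x"
    by (rule cfc_limit) (auto intro: uniform_limit_const continuous_intros)
  then show ?thesis by (simp add: poly_eval_const LIMSEQ_const_iff)
qed

lemma cfc_scaleR:
  assumes "continuous_on (Re ` spectrum x) F"
  shows "cfc (\<lambda>t. c * F t) x = c *\<^sub>R cfc F x"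
  using cfc_mult[of "\<lambda>_. c" F] assms by (simp add: cfc_const scaleR_conv_of_real)

lemma cfc_sum:
  assumes "finite S" "\<And>i. i \<in> S \<Longrightarrow> continuous_on (Re ` spectrum x) (F i)"
  shows "cfc (\<lambda>t. \<Sum>i\<in>S. F i t) x = (\<Sum>i\<in>S. cfc (F i) x)"
  using assms
  by (induction S rule: finite_induct) (simp_all add: cfc_const cfc_add continuous_on_sum)

lemma cfc_cong:
  assumes "\<And>t. t \<in> Re ` spectrum x \<Longrightarrow> F t = G t"
  shows "cfc F x = cfc G x"
proof -
  have "uniform_limit (Re ` spectrum x) u F sequentially \<longleftrightarrow> uniform_limit (Re ` spectrum x) u G sequentially" for u
    using assms by (intro uniform_limit_cong') auto
  then show ?thesis unfolding cfc_def by simp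
qed

lemma norm_cfc_le:
  assumes F: "continuous_on (Re ` spectrum x) F"
    and e: "\<And>t. t \<in> Re ` spectrum x \<Longrightarrow> \<bar>F t\<bar> \<le> e"
  shows "norm (cfc F x) \<le> e"
proof (rule field_le_epsilon)
  fix d :: real assume d: "d > 0"
  obtain p where p: "uniform_limit (Re ` spectrum x) (\<lambda>n t. poly (p n) t) F sequentially"
    "(\<lambda>n. poly_eval (p n) x) \<longlonglongrightarrow> cfc F x" by (rule cfc_approx[OF F])
  have "\<forall>\<^sub>F n in sequentially. norm (poly_eval (p n) x) \<le> e + d"
    using uniform_limitD[OF p(1) d]
  proof eventually_elim
    case (elim n)
    show ?case
    proof (rule norm_poly_eval_le[OF x])
      fix t assume "t \<in> Re ` spectrum x"
      then show "\<bar>poly (p n) t\<bar> \<le> e + d"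
        using elim e by (force simp: dist_real_def)
    qed
  qed
  then show "norm (cfc F x) \<le> e + d"
    by (intro tendsto_upperbound[OF tendsto_norm[OF p(2)]]) simp_all
qed

lemma cfc_diff_norm_le:
  assumes F: "continuous_on (Re ` spectrum x) F" and G: "continuous_on (Re ` spectrum x) G"
    and e: "\<And>t. t \<in> Re ` spectrum x \<Longrightarrow> \<bar>F t - G t\<bar> \<le> e"
  shows "norm (cfc F x - cfc G x) \<le> e"
proof -
  have "cfc (\<lambda>t. F t + (- 1) * G t) x = cfc F x + (- 1) *\<^sub>R cfc G x"
    by (subst cfc_add) (auto intro!: continuous_intros F G simp: cfc_scaleR[OF G, of "- 1", simplified])
  moreover have "norm (cfc (\<lambda>t. F t + (- 1) * G t) x) \<le> e"
    by (rule norm_cfc_le) (use e in \<open>auto intro!: continuous_intros F G\<close>)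
  ultimately show ?thesis by simp
qed

lemma cfc_commute:
  assumes "continuous_on (Re ` spectrum x) F" "continuous_on (Re ` spectrum x) G"
  shows "cfc F x * cfc G x = cfc G x * cfc F x"
  using cfc_mult[OF assms] cfc_mult[OF assms(2,1)] by (simp add: mult.commute)

end

subsection \<open>Matrices of tracial functionals\<close>

lemma linear_real_cmul: "linear f \<Longrightarrow> linear (\<lambda>x. c * f x :: real)"
  using linear_compose_scale_right[of f c] by simp

section \<open>Order intervals and approximate Hahn decompositions\<close>

lemma cle_refl [simp]: "cle x (x::'a::cstar_algebra)"
  by (simp add: cle_def)

lemma cle_trans: "cle x y \<Longrightarrow> cle y z \<Longrightarrow> cle x (z::'a::cstar_algebra)"
  unfolding cle_def using positive_elem_add[of "y - x" "z - y"] by simp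

lemma cle_0_iff: "cle 0 x \<longleftrightarrow> positive_elem (x::'a::cstar_algebra)"
  by (simp add: cle_def)

text \<open>An approximate Hahn decomposition: any near-maximiser of \<open>\<mu>\<close> on the order interval will do.\<close>

lemma approx_Hahn:
  fixes \<mu> :: "'a::cstar_algebra \<Rightarrow> real" and a0 :: 'a
  assumes lin: "linear \<mu>" and bdd: "\<And>c. positive_elem c \<Longrightarrow> cle c a0 \<Longrightarrow> \<mu> c \<le> B"
    and a0: "positive_elem a0" and \<epsilon>: "\<epsilon> > 0"
  obtains a where "positive_elem a" "cle a a0"
    "\<And>y. positive_elem y \<Longrightarrow> cle y a \<Longrightarrow> - \<epsilon> \<le> \<mu> y"
    "\<And>y. positive_elem y \<Longrightarrow> cle y (a0 - a) \<Longrightarrow> \<mu> y \<le> \<epsilon>"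
proof -
  define S where "S = \<mu> ` {c. positive_elem c \<and> cle c a0}"
  have ne: "S \<noteq> {}" using a0 by (auto simp: S_def intro!: exI[of _ 0] simp: cle_0_iff)
  have bd: "bdd_above S" using bdd by (auto simp: S_def intro!: bdd_aboveI)
  have "Sup S - \<epsilon> < Sup S" using \<epsilon> by simp
  then obtain a where a: "positive_elem a" "cle a a0" "Sup S - \<epsilon> < \<mu> a"
    unfolding less_cSup_iff[OF ne bd] by (auto simp: S_def)
  have up: "\<mu> c \<le> Sup S" if "positive_elem c" "cle c a0" for c
    by (rule cSup_upper[OF _ bd]) (use that in \<open>auto simp: S_def\<close>)
  show ?thesis
  proof (rule that[OF a(1,2)])
    fix y assume y: "positive_elem y" "cle y a"
    have "cle (a - y) a0"
      using y(1) a(2) positive_elem_add[of "a0 - a" y] by (simp add: cle_def algebra_simps)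
    then have "\<mu> (a - y) \<le> Sup S" using y(2) by (intro up) (auto simp: cle_def)
    then show "- \<epsilon> \<le> \<mu> y" using a(3) by (simp add: linear_diff[OF lin])
  next
    fix y assume y: "positive_elem y" "cle y (a0 - a)"
    have "\<mu> (a + y) \<le> Sup S"
      using y a by (intro up positive_elem_add) (auto simp: cle_def algebra_simps)
    then show "\<mu> y \<le> \<epsilon>" using a(3) by (simp add: linear_add[OF lin])
  qed
qed

text \<open>Each functional is maximised only below the element found before, which forces the chain
  to decrease. The elements stay below 1 because the functionals are assumed bounded only
  there.\<close>

lemma approx_Hahn_chain:
  fixes \<mu> :: "nat \<Rightarrow> 'a::cstar_algebra \<Rightarrow> real"
  assumes lin: "\<And>k. linear (\<mu> k)"
    and bdd: "\<And>k. \<exists>B. \<forall>c. positive_elem c \<longrightarrow> cle c 1 \<longrightarrow> \<mu> k c \<le> B"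
    and \<epsilon>: "\<epsilon> > 0"
  obtains a where "a 0 = 1" "\<And>k. positive_elem (a k)" "\<And>k. cle (a (Suc k)) (a k)"
    "\<And>k y. positive_elem y \<Longrightarrow> cle y (a (Suc k)) \<Longrightarrow> - \<epsilon> \<le> \<mu> k y"
    "\<And>k y. positive_elem y \<Longrightarrow> cle y (a k - a (Suc k)) \<Longrightarrow> \<mu> k y \<le> \<epsilon>"
proof -
  let ?P = "\<lambda>k::nat. \<lambda>a::'a. positive_elem a \<and> cle a 1 \<and> (k = 0 \<longrightarrow> a = 1)"
  let ?Q = "\<lambda>k a b. cle b a \<and> (\<forall>y. positive_elem y \<longrightarrow> cle y b \<longrightarrow> - \<epsilon> \<le> \<mu> k y)
      \<and> (\<forall>y. positive_elem y \<longrightarrow> cle y (a - b) \<longrightarrow> \<mu> k y \<le> \<epsilon>)"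
  have "\<exists>a. \<forall>k. ?P k (a k) \<and> ?Q k (a k) (a (Suc k))"
  proof (rule dependent_nat_choice)
    show "\<exists>a. ?P 0 a" using positive_elem_of_real[of 1] by auto
    fix a k assume a: "?P k a"
    obtain B where B: "\<And>c. positive_elem c \<Longrightarrow> cle c 1 \<Longrightarrow> \<mu> k c \<le> B" using bdd by metis
    have bd: "\<mu> k c \<le> B" if "positive_elem c" "cle c a" for c
      using B that a cle_trans by blast
    obtain b where "positive_elem b \<and> ?Q k a b"
      by (rule approx_Hahn[OF lin bd conjunct1[OF a] \<epsilon>]) auto
    then show "\<exists>b. ?P (Suc k) b \<and> ?Q k a b" using a cle_trans by blast
  qed
  then obtain a where "\<forall>k. ?P k (a k) \<and> ?Q k (a k) (a (Suc k))" by blast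
  then show ?thesis by (intro that[of a]) auto
qed

text \<open>A positive 2 x 2 matrix of real tracial functionals, with rows (p, q) and (q, r). As a
  locale it can be re-instantiated with a perturbed r, on which the general case rests.\<close>

locale tracial_form =
  fixes p q r :: "'a::cstar_algebra \<Rightarrow> real"
  assumes lin: "linear p" "linear q" "linear r"
    and tr: "p (x * y) = p (y * x)" "q (x * y) = q (y * x)" "r (x * y) = r (y * x)"
    and adj_inv: "p (adj x) = p x" "q (adj x) = q x" "r (adj x) = r x"
    and form_nonneg: "positive_elem x \<Longrightarrow> 0 \<le> s\<^sup>2 * p x + 2 * s * t * q x + t\<^sup>2 * r x"
begin

lemma p_nonneg: "positive_elem x \<Longrightarrow> 0 \<le> p x"
  using form_nonneg[of x 1 0] by simp

lemma r_nonneg: "positive_elem x \<Longrightarrow> 0 \<le> r x"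
  using form_nonneg[of x 0 1] by simp

lemma abs_q_le: "positive_elem x \<Longrightarrow> \<bar>q x\<bar> \<le> (p x + r x) / 2"
  using form_nonneg[of x 1 1] form_nonneg[of x 1 "- 1"] by (simp add: abs_le_iff)

lemma p_mono: "cle x y \<Longrightarrow> p x \<le> p y"
  using p_nonneg[of "y - x"] by (simp add: cle_def linear_diff[OF lin(1)])

lemma r_mono: "cle x y \<Longrightarrow> r x \<le> r y"
  using r_nonneg[of "y - x"] by (simp add: cle_def linear_diff[OF lin(3)])

text \<open>Slicing the unit along the approximate level sets of the \<^emph>\<open>density\<close> of \<open>q\<close> with respect to \<open>r\<close>.\<close>

lemma level_slices:
  assumes C: "C > 0" "\<And>x. positive_elem x \<Longrightarrow> \<bar>q x\<bar> \<le> C * r x" and \<epsilon>: "\<epsilon> > 0" and n: "n > 0"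
  obtains d :: "nat \<Rightarrow> 'a" and t :: "nat \<Rightarrow> real"
  where "(\<Sum>k\<le>n. d k) = 1" "\<And>k. k \<le> n \<Longrightarrow> positive_elem (d k)" "\<And>k. k \<le> n \<Longrightarrow> \<bar>t k\<bar> \<le> C"
    "\<And>k y. k \<le> n \<Longrightarrow> positive_elem y \<Longrightarrow> cle y (d k) \<Longrightarrow> \<bar>q y - t k * r y\<bar> \<le> \<epsilon> + 2 * C / n * r y"
proof -
  \<comment> \<open>Equally spaced thresholds from t 0 = -C to t n = C, the range that the
    domination of q by C r leaves for the ratio of q to r.\<close>
  define t where "t k = - C + 2 * C * real k / n" for k :: nat
  \<comment> \<open>The shift to \<open>Suc k\<close> makes \<open>a (Suc k)\<close> the part where
    q is nearly above \<open>t (Suc k)\<close> times r, so on \<open>a k - a (Suc k)\<close> the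
    ratio lies nearly between \<open>t k\<close> and \<open>t (Suc k)\<close>.\<close>
  define \<mu> where "\<mu> k y = q y - t (Suc k) * r y" for k y
  have "linear (\<mu> k)" for k
    unfolding \<mu>_def by (intro linear_compose_sub linear_real_cmul lin)
  moreover have "\<exists>B. \<forall>c. positive_elem c \<longrightarrow> cle c 1 \<longrightarrow> \<mu> k c \<le> B" for k
  proof (intro exI allI impI)
    fix c :: 'a assume c: "positive_elem c" "cle c 1"
    have "\<bar>q c\<bar> \<le> (p 1 + r 1) / 2"
      using abs_q_le[OF c(1)] p_mono[OF c(2)] r_mono[OF c(2)] by simp
    moreover have "\<bar>t (Suc k) * r c\<bar> \<le> \<bar>t (Suc k)\<bar> * r 1"
      using r_mono[OF c(2)] r_nonneg[OF c(1)] by (simp add: abs_mult mult_left_mono)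
    ultimately show "\<mu> k c \<le> (p 1 + r 1) / 2 + \<bar>t (Suc k)\<bar> * r 1"
      unfolding \<mu>_def by linarith
  qed
  ultimately obtain a where a: "a 0 = 1" "\<And>k. positive_elem (a k)" "\<And>k. cle (a (Suc k)) (a k)"
    "\<And>k y. positive_elem y \<Longrightarrow> cle y (a (Suc k)) \<Longrightarrow> - \<epsilon> \<le> \<mu> k y"
    "\<And>k y. positive_elem y \<Longrightarrow> cle y (a k - a (Suc k)) \<Longrightarrow> \<mu> k y \<le> \<epsilon>"
    using approx_Hahn_chain[of \<mu> \<epsilon>] \<epsilon> by metis
  \<comment> \<open>Cutting the chain off after n makes the differences telescope to
    \<open>a 0 = 1\<close>. The last slice is all of \<open>a n\<close>; there, as for the lower
    bound on slice 0, the domination by C r replaces the missing threshold.\<close>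
  define b where "b k = (if k \<le> n then a k else 0)" for k
  define d where "d k = b k - b (Suc k)" for k
  have t_Suc: "t (Suc k) = t k + 2 * C / n" for k
    using n by (simp add: t_def field_simps)
  have b_le: "cle (b (Suc k)) (b k)" for k
    using a(2,3) by (auto simp: b_def cle_0_iff)
  have b_pos: "positive_elem (b k)" for k using a(2) by (auto simp: b_def)
  show ?thesis
  proof (rule that[of d t])
    have "(\<Sum>k<Suc n. d k) = b 0 - b (Suc n)"
      unfolding d_def by (rule sum_lessThan_telescope')
    then show "(\<Sum>k\<le>n. d k) = 1" by (simp add: lessThan_Suc_atMost b_def a(1))
    fix k assume k: "k \<le> n"
    show "positive_elem (d k)" using b_le[of k] by (simp add: d_def cle_def)
    have "0 \<le> 2 * C * real k / n" "2 * C * real k / n \<le> 2 * C"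
      using C(1) n k by (auto simp: field_simps)
    then show "\<bar>t k\<bar> \<le> C" by (simp add: t_def abs_le_iff)
    fix y assume y: "positive_elem y" "cle y (d k)"
    have ry: "r y \<ge> 0" by (rule r_nonneg[OF y(1)])
    have yb: "cle y (b k)"
      using cle_trans[OF y(2), of "b k"] b_pos by (simp add: d_def cle_def)
    have lower: "q y \<ge> t k * r y - \<epsilon>"
    proof (cases k)
      case 0
      then show ?thesis using C(2)[OF y(1)] \<epsilon> by (simp add: t_def)
    next
      case (Suc j)
      then show ?thesis using a(4)[of y j] yb k y(1) by (simp add: \<mu>_def b_def)
    qed
    have upper: "q y \<le> (t k + 2 * C / n) * r y + \<epsilon>"
    proof (cases "k = n")
      case True
      have "q y \<le> C * r y" using C(2)[OF y(1)] by simp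
      moreover have "t k = C" using True n by (simp add: t_def)
      moreover have "0 \<le> 2 * C / n * r y" using ry C(1) by simp
      ultimately show ?thesis using \<epsilon> by (simp add: distrib_right)
    next
      case False
      then show ?thesis using a(5)[of y k] y k by (simp add: \<mu>_def d_def b_def t_Suc)
    qed
    have "0 \<le> 2 * C / n * r y" using ry C(1) by simp
    then show "\<bar>q y - t k * r y\<bar> \<le> \<epsilon> + 2 * C / n * r y"
      using lower upper by (simp add: abs_le_iff distrib_right)
  qed
qed

text \<open>The hypothesis speaks only of positive y below d = e e. The shift w = M + z lies between
  0 and 2 M, so e w e / (2 M) is such a y, and traciality identifies the values at e w e and w d.
  Undoing the scaling costs 2 M, undoing the shift costs M.\<close>

lemma slice_estimate:
  assumes d: "positive_elem d" and \<delta>: "\<delta> \<ge> 0"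
    and slice: "\<And>y. positive_elem y \<Longrightarrow> cle y d \<Longrightarrow> \<bar>q y - t * r y\<bar> \<le> \<epsilon> + \<delta> * r y"
    and z: "adj z = z" "norm z \<le> M" and M: "M > 0"
  shows "\<bar>q (z * d) - t * r (z * d)\<bar> \<le> 3 * M * (\<epsilon> + \<delta> * r d)"
proof -
  obtain e where e: "adj e = e" "e * e = d" using positive_elem_sqrt[OF d] by metis
  have cyc: "q (e * w * e) = q (w * d)" "r (e * w * e) = r (w * d)" for w
    using tr(2)[of e "w * e"] tr(3)[of e "w * e"] by (simp_all add: mult.assoc e(2))
  define h where "h w = q w - t * r w" for w
  have h: "linear h" unfolding h_def by (intro linear_compose_sub linear_real_cmul lin)
  define w where "w = of_real M + z"
  have w: "positive_elem w"
    using positive_elem_of_real_minus[of "- z" M] z by (simp add: w_def adj_minus)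
  have "of_real (2 * M) - w = of_real M - z"
    unfolding w_def mult_2 of_real_add by simp
  then have w2: "positive_elem (of_real (2 * M) - w)"
    using positive_elem_of_real_minus[of z M] z by simp
  define y where "y = (1 / (2 * M)) *\<^sub>R (e * w * e)"
  have y: "positive_elem y"
    using positive_elem_conj[OF w, of e] M by (simp add: y_def e positive_elem_scaleR)
  have "d - y = (1 / (2 * M)) *\<^sub>R (e * (of_real (2 * M) - w) * e)"
    using M by (simp add: y_def algebra_simps of_real_def e(2))
  then have yd: "cle y d"
    using positive_elem_conj[OF w2, of e] M by (simp add: cle_def e positive_elem_scaleR)
  have "r y \<le> r d" by (rule r_mono[OF yd])
  then have "\<delta> * r y \<le> \<delta> * r d" by (rule mult_left_mono[OF _ \<delta>])
  then have hy: "\<bar>h y\<bar> \<le> \<epsilon> + \<delta> * r d" using slice[OF y yd] by (simp add: h_def)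
  have hd: "\<bar>h d\<bar> \<le> \<epsilon> + \<delta> * r d" using slice[OF d cle_refl] by (simp add: h_def)
  have "z * d = w * d - M *\<^sub>R d" by (simp add: w_def algebra_simps scaleR_conv_of_real)
  then have "h (z * d) = h (w * d) - M * h d"
    by (simp add: linear_diff[OF h] linear_scale[OF h])
  moreover have "h (w * d) = 2 * M * h y"
    using M by (simp add: y_def linear_scale[OF h]) (simp add: h_def cyc)
  ultimately have "\<bar>h (z * d)\<bar> \<le> 2 * M * \<bar>h y\<bar> + M * \<bar>h d\<bar>"
    using M abs_triangle_ineq4[of "2 * M * h y" "M * h d"] by (simp add: abs_mult)
  also have "\<dots> \<le> 2 * M * (\<epsilon> + \<delta> * r d) + M * (\<epsilon> + \<delta> * r d)"
    using M hy hd by (intro add_mono mult_left_mono) auto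
  finally show ?thesis by (simp add: h_def algebra_simps)
qed

text \<open>On each slice t is fixed, so completing the square works there up to an error. The
  errors add up to at most L / n for every n, hence vanish in the limit.\<close>

lemma gram_nonneg_dominated:
  assumes C: "C > 0" "\<And>x. positive_elem x \<Longrightarrow> \<bar>q x\<bar> \<le> C * r x"
  shows "0 \<le> p (X * adj X) + 2 * q (X * adj Y) + r (Y * adj Y)"
proof -
  \<comment> \<open>The slice estimate needs a selfadjoint argument; since q is invariant under
    adjoints, it takes the same value at \<open>S\<close> as at \<open>X * adj Y\<close>.\<close>
  define S where "S = (1/2) *\<^sub>R (X * adj Y + Y * adj X)"
  have Sa: "adj S = S" by (simp add: S_def adj_scaleR adj_add adj_mult adj_adj add.commute)
  have "q (Y * adj X) = q (X * adj Y)"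
    using adj_inv(2)[of "X * adj Y"] by (simp add: adj_mult adj_adj)
  then have qS: "q S = q (X * adj Y)" by (simp add: S_def linear_scale[OF lin(2)] linear_add[OF lin(2)])
  define M where "M = norm (X * adj X) + norm S + 1"
  have M: "M > 0" "norm (X * adj X) \<le> M" "norm S \<le> M" by (auto simp: M_def add_nonneg_pos)
  define T where "T = p (X * adj X) + 2 * q S + r (Y * adj Y)"
  \<comment> \<open>A slice costs 2 C E for the X-term and 2 E for the cross term, where E carries
    the factor 3 M; this is the factor 6 (C + 1) M. The remaining factor is n times the bound on the
    summed slice errors.\<close>
  define L where "L = 6 * (C + 1) * M * (1 + 2 * C * r 1)"
  have main: "- (L / n) \<le> T" if n: "n > 0" for n :: nat
  proof -
    \<comment> \<open>There are n + 1 slices, each with additive error \<epsilon>, so the total must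
      still tend to 0. The \<delta>-part needs no such care: it sums to \<delta> times r 1.\<close>
    define \<epsilon> where "\<epsilon> = 1 / (real n + 1)\<^sup>2"
    define \<delta> where "\<delta> = 2 * C / n"
    have ed: "\<epsilon> > 0" "\<delta> \<ge> 0" using C n by (auto simp: \<epsilon>_def \<delta>_def)
    obtain d t where d: "(\<Sum>k\<le>n. d k) = 1" "\<And>k. k \<le> n \<Longrightarrow> positive_elem (d k)"
      "\<And>k. k \<le> n \<Longrightarrow> \<bar>t k\<bar> \<le> C"
      "\<And>k y. k \<le> n \<Longrightarrow> positive_elem y \<Longrightarrow> cle y (d k) \<Longrightarrow> \<bar>q y - t k * r y\<bar> \<le> \<epsilon> + \<delta> * r y"
      using level_slices[OF C ed(1) n] unfolding \<delta>_def by metis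
    have split: "u Z = (\<Sum>k\<le>n. u (Z * d k))" if "linear u" for u :: "'a \<Rightarrow> real" and Z
      using linear_sum[OF that, of "\<lambda>k. Z * d k" "{..n}"] d(1) by (simp flip: sum_distrib_left)
    have slice: "- (6 * (C + 1) * M * (\<epsilon> + \<delta> * r (d k)))
        \<le> p (X * adj X * d k) + 2 * q (S * d k) + r (Y * adj Y * d k)" if k: "k \<le> n" for k
    proof -
      obtain e where e: "adj e = e" "e * e = d k" using positive_elem_sqrt[OF d(2)[OF k]] by metis
      have cyc: "p (w * d k) = p (e * w * e)" "q (w * d k) = q (e * w * e)" "r (w * d k) = r (e * w * e)" for w
        using tr(1)[of e "w * e"] tr(2)[of e "w * e"] tr(3)[of e "w * e"]
        by (simp_all add: mult.assoc e(2))
      have conj: "positive_elem (e * (w * adj w) * e)" for w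
        using positive_elem_conj[OF positive_elem_mult_adj, of e w] by (simp add: e)
      define E where "E = 3 * M * (\<epsilon> + \<delta> * r (d k))"
      have "r (d k) \<ge> 0" by (rule r_nonneg[OF d(2)[OF k]])
      then have E: "E \<ge> 0" using ed M(1) by (simp add: E_def)
      have qx: "\<bar>q (X * adj X * d k) - t k * r (X * adj X * d k)\<bar> \<le> E"
        unfolding E_def using d(4)[OF k] M
        by (intro slice_estimate[OF d(2)[OF k] ed(2)]) (auto simp: adj_mult adj_adj)
      have qs: "\<bar>q (S * d k) - t k * r (S * d k)\<bar> \<le> E"
        unfolding E_def using d(4)[OF k] M Sa
        by (intro slice_estimate[OF d(2)[OF k] ed(2)]) auto
      let ?x = "r (X * adj X * d k)" and ?s = "r (S * d k)" and ?y = "r (Y * adj Y * d k)"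
      \<comment> \<open>The assumed form at s = 1, t = - t k; inserting that q is nearly t k times r
        turns it into p being nearly above the square of t k times r.\<close>
      have px: "p (X * adj X * d k) \<ge> 2 * t k * q (X * adj X * d k) - (t k)\<^sup>2 * ?x"
        using form_nonneg[OF conj[of X], of 1 "- t k"] by (simp add: cyc)
      have "\<bar>t k * (q (X * adj X * d k) - t k * ?x)\<bar> \<le> C * E"
        unfolding abs_mult using d(3)[OF k] qx E by (intro mult_mono) auto
      then have "t k * q (X * adj X * d k) \<ge> (t k)\<^sup>2 * ?x - C * E"
        by (simp add: abs_le_iff algebra_simps power2_eq_square)
      then have px': "p (X * adj X * d k) \<ge> (t k)\<^sup>2 * ?x - 2 * C * E" using px by simp
      define Z where "Z = t k *\<^sub>R X + Y"
      have "Z * adj Z = (t k)\<^sup>2 *\<^sub>R (X * adj X) + (2 * t k) *\<^sub>R S + Y * adj Y"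
        by (simp add: Z_def S_def adj_add adj_scaleR algebra_simps power2_eq_square)
      then have "r (Z * adj Z * d k) = (t k)\<^sup>2 * ?x + 2 * t k * ?s + ?y"
        by (simp add: distrib_right linear_add[OF lin(3)] linear_scale[OF lin(3)])
      moreover have "r (Z * adj Z * d k) \<ge> 0"
        using r_nonneg[OF conj[of Z]] by (simp add: cyc)
      ultimately have "0 \<le> (t k)\<^sup>2 * ?x + 2 * t k * ?s + ?y" by simp
      moreover have "q (S * d k) \<ge> t k * ?s - E" using qs by (simp add: abs_le_iff)
      ultimately have "p (X * adj X * d k) + 2 * q (S * d k) + ?y \<ge> - (2 * C * E) - 2 * E"
        using px' by simp
      then show ?thesis by (simp add: E_def algebra_simps)
    qed
    have "T = (\<Sum>k\<le>n. p (X * adj X * d k) + 2 * q (S * d k) + r (Y * adj Y * d k))"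
      unfolding T_def
      by (subst split[OF lin(1)], subst split[OF lin(2)], subst split[OF lin(3), of "Y * adj Y"])
        (simp add: sum.distrib sum_distrib_left)
    also have "\<dots> \<ge> (\<Sum>k\<le>n. - (6 * (C + 1) * M * (\<epsilon> + \<delta> * r (d k))))"
      by (intro sum_mono slice) simp
    also have "(\<Sum>k\<le>n. - (6 * (C + 1) * M * (\<epsilon> + \<delta> * r (d k))))
        = - (6 * (C + 1) * M * (\<Sum>k\<le>n. \<epsilon> + \<delta> * r (d k)))"
      by (simp only: sum_negf sum_distrib_left)
    also have "(\<Sum>k\<le>n. \<epsilon> + \<delta> * r (d k)) = (real n + 1) * \<epsilon> + \<delta> * r 1"
      using split[OF lin(3), of 1] by (simp add: sum.distrib sum_distrib_left[symmetric] algebra_simps)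
    finally have "- (6 * (C + 1) * M * ((real n + 1) * \<epsilon> + \<delta> * r 1)) \<le> T" .
    moreover have "6 * (C + 1) * M * ((real n + 1) * \<epsilon> + \<delta> * r 1) \<le> 6 * (C + 1) * M * ((1 + 2 * C * r 1) / n)"
    proof (rule mult_left_mono)
      have "real n + 1 > 0" by simp
      then have "(real n + 1) * \<epsilon> = 1 / (real n + 1)"
        by (simp add: \<epsilon>_def power2_eq_square divide_simps)
      also have "\<dots> \<le> 1 / n" using n by (simp add: frac_le)
      finally show "(real n + 1) * \<epsilon> + \<delta> * r 1 \<le> (1 + 2 * C * r 1) / n"
        by (simp add: \<delta>_def add_divide_distrib)
    qed (use C M in simp)
    ultimately show ?thesis by (simp add: L_def)
  qed
  have "(\<lambda>n. - (L / real (Suc n))) \<longlonglongrightarrow> - 0"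
    by (intro tendsto_minus LIMSEQ_Suc[OF lim_const_over_n])
  then have "- 0 \<le> T"
    by (rule tendsto_upperbound) (auto simp del: of_nat_Suc intro!: always_eventually main)
  then show ?thesis by (simp add: T_def qS)
qed

text \<open>Domination is manufactured: q is at most (p + r) / 2 in absolute value on positive
  elements, so it is dominated once \<eta> (p + r) is added to r. The price at
  \<open>Y * adj Y\<close> is \<eta> N, at most the given e.\<close>

lemma gram_nonneg: "0 \<le> p (X * adj X) + 2 * q (X * adj Y) + r (Y * adj Y)"
proof (rule field_le_epsilon)
  fix e :: real assume e: "e > 0"
  define N where "N = p (Y * adj Y) + r (Y * adj Y)"
  have N: "N \<ge> 0" using p_nonneg r_nonneg positive_elem_mult_adj[of Y] by (simp add: N_def)
  define \<eta> where "\<eta> = e / (N + 1)"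
  have \<eta>: "\<eta> > 0" "\<eta> * N \<le> e" using e N by (auto simp: \<eta>_def field_simps)
  interpret r': tracial_form p q "\<lambda>x. r x + \<eta> * (p x + r x)"
  proof (rule tracial_form.intro)
    show "linear (\<lambda>x. r x + \<eta> * (p x + r x))"
      by (intro linear_compose_add linear_real_cmul lin)
    fix x :: 'a and s t :: real assume x: "positive_elem x"
    have "0 \<le> t\<^sup>2 * (\<eta> * (p x + r x))" using \<eta>(1) p_nonneg[OF x] r_nonneg[OF x] by simp
    then show "0 \<le> s\<^sup>2 * p x + 2 * s * t * q x + t\<^sup>2 * (r x + \<eta> * (p x + r x))"
      using form_nonneg[OF x, of s t] by (simp add: distrib_left)
  qed (use lin tr adj_inv in auto)
  have "\<bar>q x\<bar> \<le> 1 / (2 * \<eta>) * (r x + \<eta> * (p x + r x))" if x: "positive_elem x" for x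
  proof -
    have "\<bar>q x\<bar> \<le> (p x + r x) / 2" by (rule abs_q_le[OF x])
    also have "\<dots> = 1 / (2 * \<eta>) * (\<eta> * (p x + r x))" using \<eta>(1) by simp
    also have "\<dots> \<le> 1 / (2 * \<eta>) * (r x + \<eta> * (p x + r x))"
      using \<eta>(1) r_nonneg[OF x] by (intro mult_left_mono) auto
    finally show ?thesis .
  qed
  then have "0 \<le> p (X * adj X) + 2 * q (X * adj Y) + (r (Y * adj Y) + \<eta> * N)"
    using r'.gram_nonneg_dominated[of "1 / (2 * \<eta>)" X Y] \<eta>(1) by (simp add: N_def)
  then show "0 \<le> p (X * adj X) + 2 * q (X * adj Y) + r (Y * adj Y) + e" using \<eta>(2) by simp
qed

end

subsection \<open>Partitions of unity in the functional calculus\<close>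

text \<open>Tent functions of radius \<delta> centred at a finite \<delta>-net, divided by their
  sum; the sum is positive on K because the net covers K.\<close>

lemma compact_partition_of_unity:
  fixes K :: "real set"
  assumes K: "compact K" and \<delta>: "\<delta> > 0"
  obtains T w where "finite T" "T \<subseteq> K" "\<And>s. s \<in> T \<Longrightarrow> continuous_on K (w s)"
    "\<And>s t. s \<in> T \<Longrightarrow> t \<in> K \<Longrightarrow> 0 \<le> (w s t :: real)" "\<And>t. t \<in> K \<Longrightarrow> (\<Sum>s\<in>T. w s t) = 1"
    "\<And>s t. s \<in> T \<Longrightarrow> t \<in> K \<Longrightarrow> \<delta> \<le> \<bar>s - t\<bar> \<Longrightarrow> w s t = 0"
proof -
  obtain T where T: "finite T" "T \<subseteq> K" "K \<subseteq> (\<Union>s\<in>T. ball s \<delta>)"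
    using seq_compact_imp_totally_bounded[OF compact_imp_seq_compact[OF K], rule_format, OF \<delta>]
    by (elim exE conjE)
  define h where "h s t = max 0 (\<delta> - \<bar>s - t\<bar>)" for s t :: real
  define H where "H t = (\<Sum>s\<in>T. h s t)" for t
  have h0: "0 \<le> h s t" for s t by (simp add: h_def)
  have H: "H t > 0" if t: "t \<in> K" for t
  proof -
    obtain s where s: "s \<in> T" "dist s t < \<delta>" using T(3) t by auto
    then have "0 < h s t" by (simp add: h_def dist_real_def)
    then show ?thesis unfolding H_def using s(1) T(1) h0 by (intro sum_pos2) auto
  qed
  have hc: "continuous_on K (h s)" for s
    unfolding h_def by (intro continuous_intros)
  have Hc: "continuous_on K H"
    unfolding H_def by (intro continuous_intros hc)
  show ?thesis
  proof (rule that[of T "\<lambda>s t. h s t / H t"])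
    show "continuous_on K (\<lambda>t. h s t / H t)" if "s \<in> T" for s
      using H by (intro continuous_on_divide hc Hc) fastforce
    show "0 \<le> h s t / H t" if "s \<in> T" "t \<in> K" for s t
      using h0[of s t] H[OF that(2)] by simp
    show "(\<Sum>s\<in>T. h s t / H t) = 1" if "t \<in> K" for t
      using H[OF that] by (simp add: H_def flip: sum_divide_distrib)
    show "h s t / H t = 0" if "\<delta> \<le> \<bar>s - t\<bar>" for s t
      using that by (simp add: h_def)
  qed (use T in auto)
qed

text \<open>The partition is chosen before F, using a common modulus of uniform continuity: f, g and
  their product must be approximated with the same weights \<open>v s\<close> for their terms to
  combine.\<close>

lemma cfc_partition:
  fixes x :: "'a::cstar_algebra"
  assumes x: "adj x = x" and F: "finite \<F>" "\<And>F. F \<in> \<F> \<Longrightarrow> continuous_on (Re ` spectrum x) F"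
    and \<epsilon>: "\<epsilon> > 0"
  obtains T v where "finite T" "T \<subseteq> Re ` spectrum x" "\<And>s. s \<in> T \<Longrightarrow> positive_elem (v s)"
    "(\<Sum>s\<in>T. v s) = 1" "\<And>F. F \<in> \<F> \<Longrightarrow> norm ((\<Sum>s\<in>T. F s *\<^sub>R v s) - cfc F x) \<le> \<epsilon>"
proof -
  define K where "K = Re ` spectrum x"
  have K: "compact K" unfolding K_def by (rule compact_Re_spectrum)
  have "\<exists>\<delta>>0. \<forall>F\<in>\<F>. \<forall>s\<in>K. \<forall>t\<in>K. \<bar>s - t\<bar> < \<delta> \<longrightarrow> \<bar>F s - F t\<bar> < \<epsilon>"
    using F
  proof (induction \<F> rule: finite_induct)
    case empty
    show ?case by (auto intro: exI[of _ 1])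
  next
    case (insert G \<G>)
    then obtain \<delta> where \<delta>: "\<delta> > 0"
      "\<forall>F\<in>\<G>. \<forall>s\<in>K. \<forall>t\<in>K. \<bar>s - t\<bar> < \<delta> \<longrightarrow> \<bar>F s - F t\<bar> < \<epsilon>" by auto
    have "uniformly_continuous_on K G"
      using insert.prems K by (intro compact_uniformly_continuous) (auto simp: K_def)
    then obtain \<delta>' where \<delta>': "\<delta>' > 0" "\<forall>s\<in>K. \<forall>t\<in>K. \<bar>s - t\<bar> < \<delta>' \<longrightarrow> \<bar>G s - G t\<bar> < \<epsilon>"
      unfolding uniformly_continuous_on_def dist_real_def using \<epsilon> by (metis abs_minus_commute)
    show ?case
      using \<delta> \<delta>' by (intro exI[of _ "min \<delta> \<delta>'"]) auto
  qed
  then obtain \<delta> where \<delta>: "\<delta> > 0" "\<And>F s t. F \<in> \<F> \<Longrightarrow> s \<in> K \<Longrightarrow> t \<in> K \<Longrightarrow> \<bar>s - t\<bar> < \<delta> \<Longrightarrow> \<bar>F s - F t\<bar> < \<epsilon>"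
    by blast
  obtain T w where T: "finite T" "T \<subseteq> K" and w: "\<And>s. s \<in> T \<Longrightarrow> continuous_on K (w s)"
    "\<And>s t. s \<in> T \<Longrightarrow> t \<in> K \<Longrightarrow> 0 \<le> (w s t :: real)" "\<And>t. t \<in> K \<Longrightarrow> (\<Sum>s\<in>T. w s t) = 1"
    "\<And>s t. s \<in> T \<Longrightarrow> t \<in> K \<Longrightarrow> \<delta> \<le> \<bar>s - t\<bar> \<Longrightarrow> w s t = 0"
    by (rule compact_partition_of_unity[OF K \<delta>(1)]) blast
  show ?thesis
  proof (rule that[of T "\<lambda>s. cfc (w s) x"])
    show "positive_elem (cfc (w s) x)" if s: "s \<in> T" for s
    proof -
      \<comment> \<open>Positivity comes from writing the weight as a square inside the functional
        calculus.\<close>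
      have c: "continuous_on K (\<lambda>t. sqrt (w s t))" by (intro continuous_intros w(1) s)
      have "cfc (w s) x = cfc (\<lambda>t. sqrt (w s t) * sqrt (w s t)) x"
        by (rule cfc_cong[OF x]) (use w(2)[OF s] in \<open>auto simp: K_def\<close>)
      also have "\<dots> = cfc (\<lambda>t. sqrt (w s t)) x * cfc (\<lambda>t. sqrt (w s t)) x"
        using c by (intro cfc_mult x) (simp_all add: K_def)
      finally show ?thesis
        using positive_elem_square[OF adj_cfc[OF x]] c by (simp add: K_def)
    qed
    have "(\<Sum>s\<in>T. cfc (w s) x) = cfc (\<lambda>t. \<Sum>s\<in>T. w s t) x"
      using T w(1) by (subst cfc_sum[OF x]) (auto simp: K_def)
    also have "\<dots> = cfc (\<lambda>_. 1) x"
      by (rule cfc_cong[OF x]) (use w(3) in \<open>auto simp: K_def\<close>)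
    finally show "(\<Sum>s\<in>T. cfc (w s) x) = 1" by (simp add: cfc_const[OF x])
    fix G assume G: "G \<in> \<F>"
    have "(\<Sum>s\<in>T. G s *\<^sub>R cfc (w s) x) = (\<Sum>s\<in>T. cfc (\<lambda>t. G s * w s t) x)"
      using w(1) by (intro sum.cong refl cfc_scaleR[OF x, symmetric]) (auto simp: K_def)
    also have "\<dots> = cfc (\<lambda>t. \<Sum>s\<in>T. G s * w s t) x"
      using T w(1) by (subst cfc_sum[OF x]) (auto simp: K_def intro!: continuous_intros)
    finally have eq: "(\<Sum>s\<in>T. G s *\<^sub>R cfc (w s) x) = cfc (\<lambda>t. \<Sum>s\<in>T. G s * w s t) x" .
    show "norm ((\<Sum>s\<in>T. G s *\<^sub>R cfc (w s) x) - cfc G x) \<le> \<epsilon>"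
      unfolding eq
    proof (rule cfc_diff_norm_le[OF x])
      show "continuous_on (Re ` spectrum x) (\<lambda>t. \<Sum>s\<in>T. G s * w s t)"
        using w(1) by (intro continuous_intros) (auto simp: K_def)
      fix t assume "t \<in> Re ` spectrum x"
      then have t: "t \<in> K" by (simp add: K_def)
      have "(\<Sum>s\<in>T. G s * w s t) - G t = (\<Sum>s\<in>T. (G s - G t) * w s t)"
        using w(3)[OF t] by (simp add: left_diff_distrib sum_subtractf flip: sum_distrib_left)
      also have "\<bar>\<dots>\<bar> \<le> (\<Sum>s\<in>T. \<epsilon> * w s t)"
      proof (rule order_trans[OF sum_abs sum_mono])
        fix s assume s: "s \<in> T"
        show "\<bar>(G s - G t) * w s t\<bar> \<le> \<epsilon> * w s t"
        proof (cases "\<delta> \<le> \<bar>s - t\<bar>")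
          case True
          then show ?thesis using w(4)[OF s t] by simp
        next
          case False
          then have "\<bar>G s - G t\<bar> \<le> \<epsilon>" using \<delta>(2)[OF G _ t, of s] s T(2) by fastforce
          then show ?thesis using w(2)[OF s t] by (simp add: abs_mult mult_right_mono)
        qed
      qed
      also have "\<dots> = \<epsilon>" using w(3)[OF t] by (simp flip: sum_distrib_left)
      finally show "\<bar>(\<Sum>s\<in>T. G s * w s t) - G t\<bar> \<le> \<epsilon>" .
    qed (use F(2)[OF G] in auto)
  qed (use T in \<open>auto simp: K_def\<close>)
qed

subsection \<open>Positivity of the skew information form\<close>

context tracial_form
begin

text \<open>Supplies the continuity for the passage from step functions to f and g. For selfadjoint
  h of norm m, h is the difference of m + h, which lies between 0 and 2 m, and m; this gives 2 N + N
  = 3 N. Adjoint invariance reduces x to its selfadjoint part.\<close>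

lemma bounded_linear_of_bound_on_positive:
  assumes u: "linear u" "\<And>x. u (adj x) = u x"
    and bd: "\<And>y. positive_elem y \<Longrightarrow> \<bar>u y :: real\<bar> \<le> p y + r y"
  shows "bounded_linear u"
proof -
  define N where "N = p 1 + r 1"
  have one: "positive_elem (1::'a)" using positive_elem_of_real[of 1] by simp
  have N: "N \<ge> 0" using p_nonneg[OF one] r_nonneg[OF one] by (simp add: N_def)
  have le: "\<bar>u y\<bar> \<le> t * N" if y: "positive_elem y" "positive_elem (of_real t - y)" for y t
  proof -
    have "cle y (t *\<^sub>R 1)" using y(2) by (simp add: cle_def of_real_def)
    then have "p y \<le> t * p 1" "r y \<le> t * r 1"
      using p_mono r_mono by (fastforce simp: linear_scale[OF lin(1)] linear_scale[OF lin(3)])+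
    then show ?thesis using bd[OF y(1)] by (simp add: N_def distrib_left)
  qed
  have sa: "\<bar>u h\<bar> \<le> 3 * N * norm h" if h: "adj h = h" for h :: 'a
  proof -
    let ?m = "norm h"
    have 1: "positive_elem (of_real ?m + h)"
      using positive_elem_of_real_minus[of "- h" ?m] h by (simp add: adj_minus)
    have eq: "of_real (2 * ?m) - (of_real ?m + h) = of_real ?m - h"
      unfolding mult_2 of_real_add by simp
    have 2: "positive_elem (of_real (2 * ?m) - (of_real ?m + h))"
      unfolding eq using positive_elem_of_real_minus[of h ?m] h by simp
    have "\<bar>u (of_real ?m + h)\<bar> \<le> 2 * ?m * N" by (rule le[OF 1 2])
    moreover have "\<bar>u (of_real ?m)\<bar> \<le> ?m * N" by (rule le) (auto intro: positive_elem_of_real)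
    ultimately have "\<bar>u (of_real ?m) + u h\<bar> \<le> 2 * ?m * N" "\<bar>u (of_real ?m)\<bar> \<le> ?m * N"
      by (simp_all add: linear_add[OF u(1)])
    then have "\<bar>u h\<bar> \<le> 2 * ?m * N + ?m * N" by linarith
    then show ?thesis by (simp add: algebra_simps)
  qed
  show ?thesis
  proof (rule bounded_linear_intro[of u "3 * N"])
    fix x :: 'a
    define h where "h = (1/2) *\<^sub>R (x + adj x)"
    have h: "adj h = h" by (simp add: h_def adj_scaleR adj_add adj_adj add.commute)
    have "u h = u x" by (simp add: h_def linear_scale[OF u(1)] linear_add[OF u(1)] u(2))
    moreover have hx: "norm h \<le> norm x"
      using norm_triangle_ineq[of x "adj x"] by (simp add: h_def)
    moreover have "3 * N * norm h \<le> 3 * N * norm x"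
      using N hx by (intro mult_left_mono) auto
    ultimately have "\<bar>u x\<bar> \<le> 3 * N * norm x" using sa[OF h] by linarith
    then show "norm (u x) \<le> norm x * (3 * N)" by (simp add: mult.commute)
  qed (use u(1) in \<open>simp_all add: linear_add linear_scale\<close>)
qed

lemma bounded_linear_p: "bounded_linear p"
  by (rule bounded_linear_of_bound_on_positive) (use lin adj_inv p_nonneg r_nonneg in auto)

lemma bounded_linear_r: "bounded_linear r"
  by (rule bounded_linear_of_bound_on_positive) (use lin adj_inv p_nonneg r_nonneg in auto)

lemma bounded_linear_q: "bounded_linear q"
proof (rule bounded_linear_of_bound_on_positive)
  show "\<bar>q y\<bar> \<le> p y + r y" if "positive_elem y" for y
    using abs_q_le[OF that] p_nonneg[OF that] r_nonneg[OF that] by simp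
qed (use lin adj_inv in auto)

text \<open>The Gram inequality at \<open>e * A * e'\<close> and \<open>e * B * e'\<close>, with e
  and e' the roots of v and v'; traciality moves one e from the front to the end.\<close>

lemma gram_nonneg_weighted:
  assumes "positive_elem v" "positive_elem v'" "adj A = A" "adj B = B"
  shows "0 \<le> p (v * A * v' * A) + 2 * q (v * A * v' * B) + r (v * B * v' * B)"
proof -
  obtain e where e: "adj e = e" "e * e = v" using positive_elem_sqrt[OF assms(1)] by metis
  obtain e' where e': "adj e' = e'" "e' * e' = v'" using positive_elem_sqrt[OF assms(2)] by metis
  have "u (v * X * v' * Y) = u ((e * X * e') * adj (e * Y * e'))"
    if "\<And>x y. u (x * y) = u (y * x)" "adj Y = Y" for u :: "'a \<Rightarrow> real" and X Y
  proof -
    have "v * X * v' * Y = e * (e * (X * v' * Y))"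
      by (simp add: e(2)[symmetric] mult.assoc)
    moreover have "(e * X * e') * adj (e * Y * e') = e * (X * v' * Y) * e"
      using that(2) by (simp add: adj_mult e(1) e'(1) e'(2)[symmetric] mult.assoc)
    ultimately show ?thesis using that(1)[of e "e * (X * v' * Y)"] by simp
  qed
  from this[of p, OF tr(1)] this[of q, OF tr(2)] this[of r, OF tr(3)] show ?thesis
    using gram_nonneg[of "e * A * e'" "e * B * e'"] assms(3,4) by simp
qed

text \<open>For \<open>f\<close> and \<open>g\<close> replaced by step functions this is a sum of the inequalities
  \<open>gram_nonneg_weighted\<close> with the weights \<open>(f s - f t) (g s - g t) \<ge> 0\<close>.\<close>

lemma skew_form_nonneg:
  assumes \<rho>: "adj \<rho> = \<rho>" and AB: "adj A = A" "adj B = B"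
    and f: "continuous_on (Re ` spectrum \<rho>) f" and g: "continuous_on (Re ` spectrum \<rho>) g"
    and mono: "\<And>s t. s \<in> Re ` spectrum \<rho> \<Longrightarrow> t \<in> Re ` spectrum \<rho> \<Longrightarrow> 0 \<le> (f s - f t) * (g s - g t)"
  defines "a \<equiv> cfc f \<rho>" and "b \<equiv> cfc g \<rho>"
  shows "0 \<le> p (a * b * A * A - a * A * b * A) + 2 * q (a * b * A * B - a * A * b * B)
      + r (a * b * B * B - a * B * b * B)"
proof -
  \<comment> \<open>Twice the skew form, symmetrised. The slot c stands for a b but is kept
    separate: the step sum for f g is not the product of the step sums for f and g, because the
    \<open>v s\<close> need not be projections.\<close>
  define W where "W c a b X Y = c * X * Y + X * c * Y - a * X * b * Y - b * X * a * Y" for c a b X Y :: 'a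
  define \<Psi> where "\<Psi> c a b = p (W c a b A A) + 2 * q (W c a b A B) + r (W c a b B B)" for c a b
  have "\<exists>c' a' b'. norm (c' - a * b) \<le> \<epsilon> \<and> norm (a' - a) \<le> \<epsilon> \<and> norm (b' - b) \<le> \<epsilon> \<and> 0 \<le> \<Psi> c' a' b'"
    if \<epsilon>: "\<epsilon> > 0" for \<epsilon>
  proof -
    define fg where "fg t = f t * g t" for t
    have fgc: "continuous_on (Re ` spectrum \<rho>) fg"
      unfolding fg_def by (intro continuous_on_mult f g)
    have ab: "a * b = cfc fg \<rho>" unfolding a_def b_def fg_def by (rule cfc_mult[OF \<rho> f g, symmetric])
    obtain T v where T: "finite T" "T \<subseteq> Re ` spectrum \<rho>" and v: "\<And>s. s \<in> T \<Longrightarrow> positive_elem (v s)"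
      "(\<Sum>s\<in>T. v s) = 1" and ap: "\<And>F. F \<in> {f, g, fg} \<Longrightarrow> norm ((\<Sum>s\<in>T. F s *\<^sub>R v s) - cfc F \<rho>) \<le> \<epsilon>"
      by (rule cfc_partition[OF \<rho> _ _ \<epsilon>, of "{f, g, fg}"]) (use f g fgc in auto)
    define I where "I F = (\<Sum>s\<in>T. F s *\<^sub>R v s)" for F
    have expand: "I F * X * I G * Y = (\<Sum>s\<in>T. \<Sum>t\<in>T. (F s * G t) *\<^sub>R (v s * X * v t * Y))" for F G X Y
      unfolding I_def
      by (simp add: sum_distrib_left sum_distrib_right)
        (subst sum.swap, simp add: scaleR_sum_right mult.commute)
    have W: "W (I fg) (I f) (I g) X Y
        = (\<Sum>s\<in>T. \<Sum>t\<in>T. ((f s - f t) * (g s - g t)) *\<^sub>R (v s * X * v t * Y))" for X Y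
    proof -
      \<comment> \<open>Inserting the unit as the step sum of the constant 1 brings all four terms
        of \<open>W\<close> to the shape \<open>I F * X * I G * Y\<close>; the coefficients then
        combine to (f s - f t) (g s - g t).\<close>
      have one: "I (\<lambda>_. 1) = 1" by (simp add: I_def v(2))
      have "W (I fg) (I f) (I g) X Y = I fg * X * I (\<lambda>_. 1) * Y + I (\<lambda>_. 1) * X * I fg * Y
          - I f * X * I g * Y - I g * X * I f * Y"
        by (simp add: W_def one)
      also have "\<dots> = (\<Sum>s\<in>T. \<Sum>t\<in>T. (fg s * 1 + 1 * fg t - f s * g t - g s * f t) *\<^sub>R (v s * X * v t * Y))"
        unfolding expand by (simp only: sum.distrib sum_subtractf scaleR_left_distrib scaleR_left_diff_distrib)
      finally show ?thesis by (simp add: fg_def algebra_simps)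
    qed
    have uW: "u (W (I fg) (I f) (I g) X Y)
        = (\<Sum>s\<in>T. \<Sum>t\<in>T. (f s - f t) * (g s - g t) * u (v s * X * v t * Y))"
      if "linear u" for u :: "'a \<Rightarrow> real" and X Y
      unfolding W by (simp add: linear_sum[OF that] linear_scale[OF that])
    have "\<Psi> (I fg) (I f) (I g) = (\<Sum>s\<in>T. \<Sum>t\<in>T. (f s - f t) * (g s - g t) *
        (p (v s * A * v t * A) + 2 * q (v s * A * v t * B) + r (v s * B * v t * B)))"
      unfolding \<Psi>_def uW[OF lin(1)] uW[OF lin(2)] uW[OF lin(3)]
      by (simp add: distrib_left sum.distrib sum_distrib_left mult.left_commute[of 2])
    also have "\<dots> \<ge> 0"
      by (intro sum_nonneg mult_nonneg_nonneg[OF mono gram_nonneg_weighted] AB v(1) subsetD[OF T(2)])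
    finally show ?thesis
      using ap[of f] ap[of g] ap[of fg] unfolding a_def[symmetric] b_def[symmetric] ab[symmetric] I_def
      by blast
  qed
  then have "\<exists>c' a' b'. norm (c' - a * b) \<le> 1 / real (Suc n) \<and> norm (a' - a) \<le> 1 / real (Suc n)
      \<and> norm (b' - b) \<le> 1 / real (Suc n) \<and> 0 \<le> \<Psi> c' a' b'" for n
    by simp
  then obtain cs as bs where seq: "\<And>n. norm (cs n - a * b) \<le> 1 / real (Suc n)"
    "\<And>n. norm (as n - a) \<le> 1 / real (Suc n)" "\<And>n. norm (bs n - b) \<le> 1 / real (Suc n)"
    "\<And>n. 0 \<le> \<Psi> (cs n) (as n) (bs n)"
    by metis
  have conv: "X \<longlonglongrightarrow> z" if "\<And>n. norm (X n - z) \<le> 1 / real (Suc n)" for X and z :: 'a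
    by (rule LIM_zero_cancel, rule Lim_null_comparison[OF always_eventually LIMSEQ_Suc[OF lim_const_over_n]])
      (use that in auto)
  have lims: "cs \<longlonglongrightarrow> a * b" "as \<longlonglongrightarrow> a" "bs \<longlonglongrightarrow> b"
    using seq by (blast intro: conv)+
  have "(\<lambda>n. \<Psi> (cs n) (as n) (bs n)) \<longlonglongrightarrow> \<Psi> (a * b) a b"
    unfolding \<Psi>_def W_def
    by (intro tendsto_add tendsto_mult[OF tendsto_const] bounded_linear.tendsto[OF bounded_linear_p]
        bounded_linear.tendsto[OF bounded_linear_q] bounded_linear.tendsto[OF bounded_linear_r]
        tendsto_intros lims)
  then have "0 \<le> \<Psi> (a * b) a b"
    by (rule tendsto_lowerbound) (use seq(4) in auto)
  \<comment> \<open>Taking adjoints and cycling sends X (a b) Y to a b X Y and b X a Y to a X b Y,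
    so each half of \<open>W\<close> contributes the same value.\<close>
  moreover have "u (W (a * b) a b X Y) = 2 * u (a * b * X * Y - a * X * b * Y)"
    if u: "linear u" "\<And>x y. u (x * y) = u (y * x)" "\<And>x. u (adj x) = u x" and XY: "adj X = X" "adj Y = Y"
    for u :: "'a \<Rightarrow> real" and X Y
  proof -
    have sa: "adj a = a" "adj b = b" unfolding a_def b_def by (rule adj_cfc[OF \<rho>]; fact)+
    have com: "b * a = a * b" unfolding a_def b_def by (rule cfc_commute[OF \<rho> g f])
    have "u (X * (a * b) * Y) = u (Y * (a * b * X))"
      using u(3)[of "X * (a * b) * Y"] by (simp add: adj_mult sa XY com mult.assoc)
    also have "\<dots> = u (a * b * X * Y)" by (rule u(2))
    finally have 1: "u (X * (a * b) * Y) = u (a * b * X * Y)" .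
    have "u (b * X * a * Y) = u (Y * (a * X * b))"
      using u(3)[of "b * X * a * Y"] by (simp add: adj_mult sa XY mult.assoc)
    also have "\<dots> = u (a * X * b * Y)" by (rule u(2))
    finally have 2: "u (b * X * a * Y) = u (a * X * b * Y)" .
    show ?thesis unfolding W_def by (simp add: linear_add[OF u(1)] linear_diff[OF u(1)] 1 2)
  qed
  ultimately have "0 \<le> 2 * p (a * b * A * A - a * A * b * A) + 2 * (2 * q (a * b * A * B - a * A * b * B))
      + 2 * r (a * b * B * B - a * B * b * B)"
    unfolding \<Psi>_def using lin tr adj_inv AB by simp
  then show ?thesis by simp
qed

end

subsection \<open>Positive linear maps and states\<close>

lemma cartesian_decomposition:
  fixes x :: "'a::cstar_algebra"
  obtains u v where "adj u = u" "adj v = v" "x = u + scaleC \<i> v" "adj x = u - scaleC \<i> v"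
proof (rule that[of "(1/2) *\<^sub>R (x + adj x)" "scaleC (- \<i> / 2) (x - adj x)"])
  show "adj ((1/2) *\<^sub>R (x + adj x)) = (1/2) *\<^sub>R (x + adj x)"
    by (simp add: adj_scaleR adj_add adj_adj add.commute)
  show "adj (scaleC (- \<i> / 2) (x - adj x)) = scaleC (- \<i> / 2) (x - adj x)"
    by (simp add: adj_scaleC adj_diff adj_adj scaleC_diff_right scaleC_minus_left)
  have i: "scaleC \<i> (scaleC (- \<i> / 2) (x - adj x)) = (1/2) *\<^sub>R (x - adj x)"
    by (simp add: scaleC_scaleC scaleR_scaleC)
  show "x = (1/2) *\<^sub>R (x + adj x) + scaleC \<i> (scaleC (- \<i> / 2) (x - adj x))"
    unfolding i by (simp add: algebra_simps flip: scaleR_left_distrib)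
  show "adj x = (1/2) *\<^sub>R (x + adj x) - scaleC \<i> (scaleC (- \<i> / 2) (x - adj x))"
    unfolding i by (simp add: algebra_simps flip: scaleR_left_distrib)
qed

lemma linear_map_add: "linear_map \<Phi> \<Longrightarrow> \<Phi> (x + y) = \<Phi> x + \<Phi> y"
  and linear_map_scaleC: "linear_map \<Phi> \<Longrightarrow> \<Phi> (scaleC c x) = scaleC c (\<Phi> x)"
  by (auto simp: linear_map_def complex_linear_def)

lemma linear_map_linear: "linear_map \<Phi> \<Longrightarrow> linear \<Phi>"
  by (rule linearI) (simp_all add: linear_map_add linear_map_scaleC scaleR_scaleC)

text \<open>A selfadjoint h is the difference of the positive elements norm h and norm h - h, whose
  images are selfadjoint; complex linearity does the rest.\<close>

lemma positive_map_adj: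
  fixes \<Phi> :: "'a::cstar_algebra \<Rightarrow> 'b::cstar_algebra"
  assumes "linear_map \<Phi>" "positive_map \<Phi>"
  shows "\<Phi> (adj x) = adj (\<Phi> x)"
proof -
  note lin = linear_map_linear[OF assms(1)]
  have sa: "adj (\<Phi> h) = \<Phi> h" if h: "adj h = h" for h
  proof -
    have "positive_elem (\<Phi> (of_real (norm h)))" "positive_elem (\<Phi> (of_real (norm h) - h))"
      using assms(2) positive_elem_of_real_minus[OF h order_refl]
      by (simp_all add: positive_map_def positive_elem_of_real)
    then have "adj (\<Phi> (of_real (norm h)) - \<Phi> (of_real (norm h) - h)) = \<Phi> (of_real (norm h)) - \<Phi> (of_real (norm h) - h)"
      by (simp only: adj_diff positive_elemD(1))
    then show ?thesis by (simp add: linear_diff[OF lin])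
  qed
  obtain u v where uv: "adj u = u" "adj v = v" "x = u + scaleC \<i> v" "adj x = u - scaleC \<i> v"
    by (rule cartesian_decomposition)
  have "\<Phi> (adj x) = \<Phi> u - scaleC \<i> (\<Phi> v)"
    unfolding uv(4) by (simp add: linear_diff[OF lin] linear_map_scaleC[OF assms(1)])
  moreover have "\<Phi> x = \<Phi> u + scaleC \<i> (\<Phi> v)"
    unfolding uv(3) by (simp add: linear_map_add[OF assms(1)] linear_map_scaleC[OF assms(1)])
  ultimately show ?thesis
    by (simp add: adj_add adj_scaleC sa uv(1,2) scaleC_minus_left)
qed

context
  fixes \<phi> :: "'a::cstar_algebra \<Rightarrow> complex"
  assumes \<phi>: "normal_state \<phi>"
begin

lemma state_add: "\<phi> (x + y) = \<phi> x + \<phi> y"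
  and state_scaleC: "\<phi> (scaleC c x) = c * \<phi> x"
  using \<phi> by (auto simp: normal_state_def complex_linear_def)

lemma state_linear: "linear \<phi>"
  by (rule linearI) (simp_all add: state_add state_scaleC scaleR_scaleC scaleR_conv_of_real)

lemma state_positive: "positive_elem x \<Longrightarrow> 0 \<le> Re (\<phi> x) \<and> Im (\<phi> x) = 0"
  using \<phi> by (auto simp: normal_state_def)

lemma state_adj: "\<phi> (adj x) = cnj (\<phi> x)"
proof -
  have sa: "Im (\<phi> h) = 0" if h: "adj h = h" for h
  proof -
    have "Im (\<phi> (of_real (norm h))) = 0" "Im (\<phi> (of_real (norm h) - h)) = 0"
      using state_positive[OF positive_elem_of_real_minus[OF h order_refl]]
        state_positive[OF positive_elem_of_real[OF norm_ge_zero[of h]]] by simp_all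
    then show ?thesis by (simp add: linear_diff[OF state_linear])
  qed
  obtain u v where uv: "adj u = u" "adj v = v" "x = u + scaleC \<i> v" "adj x = u - scaleC \<i> v"
    by (rule cartesian_decomposition)
  have "\<phi> (adj x) = \<phi> u - \<i> * \<phi> v"
    unfolding uv(4) by (simp add: linear_diff[OF state_linear] state_scaleC)
  moreover have "\<phi> x = \<phi> u + \<i> * \<phi> v"
    unfolding uv(3) by (simp add: state_add state_scaleC)
  ultimately show ?thesis using sa[OF uv(1)] sa[OF uv(2)] by (simp add: complex_eq_iff)
qed

end

text \<open>Elements b of the algebra play the part of vectors. Testing with b = n, from the
  negative part of h, gives -(k k); so every normal state vanishes on the positive k k, and
  separation makes it 0.\<close>

lemma positive_elem_by_states:
  fixes h :: "'b::cstar_algebra"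
  assumes vn: "vn_algebra TYPE('b)" and h: "adj h = h"
    and st: "\<And>\<phi> b. normal_state \<phi> \<Longrightarrow> 0 \<le> Re (\<phi> (adj b * h * b))"
  shows "positive_elem h"
proof -
  obtain n k where n: "adj n = n" and k: "adj k = k" and nhn: "n * h * n = - (k * k)"
    and h_pos: "k * k = 0 \<Longrightarrow> positive_elem h"
    by (rule negative_part[OF h]) blast
  have "\<phi> (k * k) = 0" if \<phi>: "normal_state \<phi>" for \<phi>
  proof -
    have "0 \<le> Re (\<phi> (- (k * k)))" using st[OF \<phi>, of n] by (simp add: n nhn)
    then show ?thesis
      using state_positive[OF \<phi> positive_elem_square[OF k]]
      by (simp add: linear_neg[OF state_linear[OF \<phi>]] complex_eq_iff)
  qed
  then show ?thesis
    using vn positive_elem_square[OF k] h_pos unfolding vn_algebra_def by blast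
qed

text \<open>Nonnegativity of the form is positivity of \<open>\<Phi> x\<close> tested at the vector
  s y + t z. An adjoint exchanges the two cross terms, so their mean is both the coefficient that
  the expansion yields and adjoint invariant.\<close>

lemma tracial_form_state:
  fixes \<Phi> :: "'a::cstar_algebra \<Rightarrow> 'b::cstar_algebra"
  assumes lin: "linear_map \<Phi>" and pos: "positive_map \<Phi>" and tr: "tracial \<Phi>" and \<phi>: "normal_state \<phi>"
  shows "tracial_form (\<lambda>x. Re (\<phi> (adj y * \<Phi> x * y)))
    (\<lambda>x. (Re (\<phi> (adj y * \<Phi> x * z)) + Re (\<phi> (adj z * \<Phi> x * y))) / 2)
    (\<lambda>x. Re (\<phi> (adj z * \<Phi> x * z)))"
proof -
  define F where "F v w x = Re (\<phi> (adj v * \<Phi> x * w))" for v w x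
  have F: "linear (F v w)" for v w
    unfolding F_def
    by (rule linearI)
      (simp_all add: linear_add[OF linear_map_linear[OF lin]] linear_scale[OF linear_map_linear[OF lin]]
        algebra_simps state_add[OF \<phi>] linear_scale[OF state_linear[OF \<phi>]])
  have tr_F: "F v w (x * x') = F v w (x' * x)" for v w x x'
    using tr by (simp add: F_def tracial_def)
  have adj_F: "F v w (adj x) = F w v x" for v w x
    using arg_cong[OF state_adj[OF \<phi>, of "adj w * \<Phi> x * v"], of Re]
    by (simp add: F_def positive_map_adj[OF lin pos] adj_mult adj_adj mult.assoc)
  have "tracial_form (F y y) (\<lambda>x. (F y z x + F z y x) / 2) (F z z)"
  proof (rule tracial_form.intro)
    show "linear (\<lambda>x. (F y z x + F z y x) / 2)"
      using linear_real_cmul[OF linear_compose_add[OF F[of y z] F[of z y]], of "1/2"] by simp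
    fix x :: 'a and s t :: real assume x: "positive_elem x"
    define v where "v = s *\<^sub>R y + t *\<^sub>R z"
    have "0 \<le> F v v x"
      unfolding F_def
      using pos x state_positive[OF \<phi> positive_elem_conj[of "\<Phi> x" v]] by (simp add: positive_map_def)
    also have "F v v x = s\<^sup>2 * F y y x + 2 * s * t * ((F y z x + F z y x) / 2) + t\<^sup>2 * F z z x"
      by (simp add: F_def v_def adj_add adj_scaleR algebra_simps state_add[OF \<phi>]
          linear_scale[OF state_linear[OF \<phi>]] power2_eq_square)
    finally show "0 \<le> s\<^sup>2 * F y y x + 2 * s * t * ((F y z x + F z y x) / 2) + t\<^sup>2 * F z z x" .
  qed (simp_all add: F adj_F tr_F add.commute)
  then show ?thesis by (simp add: F_def[abs_def])
qed

subsection \<open>Positive two-by-two matrices\<close>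

lemma invertible_elem_of_real_add_positive:
  fixes c :: "'a::cstar_algebra"
  assumes "positive_elem c" "\<epsilon> > 0"
  shows "invertible_elem (of_real \<epsilon> + c)"
proof (rule invertible_elem_near_of_real)
  have eq: "of_real (norm c + \<epsilon>) - (of_real \<epsilon> + c) = of_real (norm c) - c" by simp
  show "norm (of_real (norm c + \<epsilon>) - (of_real \<epsilon> + c)) < norm c + \<epsilon>"
    unfolding eq using positive_elemD(2)[OF assms(1)] assms(2) by linarith
qed

text \<open>Congruence by the inverse root of 1 + c turns the element into g - i \<beta> with g
  selfadjoint, and the spectrum of g is real.\<close>

lemma invertible_elem_definite_imaginary_part:
  fixes h c :: "'a::cstar_algebra"
  assumes h: "adj h = h" and c: "positive_elem c" and \<beta>: "\<beta> \<noteq> 0"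
  shows "invertible_elem (h - scaleC (\<i> * of_real \<beta>) (1 + c))"
proof -
  have one: "positive_elem (1 + c)"
    using positive_elem_add[OF positive_elem_of_real[of 1] c] by simp
  obtain s where s: "adj s = s" "s * s = 1 + c" using positive_elem_sqrt[OF one] by metis
  have "invertible_elem (s * s)"
    using invertible_elem_of_real_add_positive[OF c, of 1] by (simp add: s)
  then have si: "invertible_elem s" by (rule invertible_elem_commuting_factor) simp
  then obtain s' where s': "s * s' = 1" "s' * s = 1" by (auto simp: invertible_elem_def)
  have "adj s' * s = 1" using arg_cong[OF s'(1), of adj] by (simp add: adj_mult s)
  then have s'a: "adj s' = s'" by (metis s'(1) mult.assoc mult.left_neutral mult.right_neutral)
  define g where "g = s' * h * s'"
  have "adj g = g" by (simp add: g_def adj_mult s'a h mult.assoc)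
  then have "\<i> * of_real \<beta> \<notin> spectrum g"
    using spectrum_selfadjoint_real[of g "\<i> * of_real \<beta>"] \<beta> by auto
  then have "invertible_elem (s * (g - scaleC (\<i> * of_real \<beta>) 1) * s)"
    by (intro invertible_elem_mult si) (simp add: spectrum_iff)
  moreover have "s * g * s = h"
  proof -
    have "s * g * s = (s * s') * h * (s' * s)" by (simp add: g_def mult.assoc)
    then show ?thesis by (simp add: s')
  qed
  then have "s * (g - scaleC (\<i> * of_real \<beta>) 1) * s = h - scaleC (\<i> * of_real \<beta>) (1 + c)"
    by (simp add: left_diff_distrib right_diff_distrib scaleC_mult_left scaleC_mult_right s)
  ultimately show ?thesis by simp
qed

text \<open>\<open>?Y\<close> is the block inverse built from the inverse P' of the corner and the
  inverse W' of its Schur complement.\<close>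

lemma m2_invertible_Schur:
  fixes P Q R P' W' :: "'a::cstar_algebra"
  assumes P: "P * P' = 1" "P' * P = 1"
    and W: "(R - Q * P' * Q) * W' = 1" "W' * (R - Q * P' * Q) = 1"
  shows "m2_invertible (P, Q, Q, R)"
  unfolding m2_invertible_def
proof (intro exI conjI)
  let ?Y = "(P' + P' * Q * W' * Q * P', - (P' * Q * W'), - (W' * Q * P'), W')"
  have RW: "R * W' = 1 + Q * P' * Q * W'" and WR: "W' * R = 1 + W' * Q * P' * Q"
    using W by (simp_all add: algebra_simps)
  have PX: "P * (P' * X) = X" "X * P' * P = X" "P' * (P * X) = X" for X
    by (simp_all add: P mult.assoc flip: mult.assoc[of P P' X] mult.assoc[of P' P X])
  show "m2_mult (P, Q, Q, R) ?Y = (1, 0, 0, 1)"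
  proof -
    have "R * (W' * Q * P') = (1 + Q * P' * Q * W') * (Q * P')"
      unfolding RW[symmetric] by (simp add: mult.assoc)
    then show ?thesis
      using RW by (simp add: algebra_simps P PX)
  qed
  show "m2_mult ?Y (P, Q, Q, R) = (1, 0, 0, 1)"
  proof -
    have "P' * Q * W' * R = P' * Q * (1 + W' * Q * P' * Q)"
      unfolding WR[symmetric] by (simp add: mult.assoc)
    then show ?thesis
      using WR by (simp add: algebra_simps P PX)
  qed
qed

text \<open>Positivity is spectral, so the matrix shifted by each w off the half line must be
  inverted. For w = - \<epsilon> the Schur complement of the shifted matrix is \<epsilon> plus a
  positive element; for nonreal w its imaginary part is definite.\<close>

lemma m2_positiveI:
  fixes P Q R :: "'b::cstar_algebra"
  assumes vn: "vn_algebra TYPE('b)" and PQR: "adj P = P" "adj Q = Q" "adj R = R"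
    and form: "\<And>\<phi> y z. normal_state \<phi> \<Longrightarrow>
      0 \<le> Re (\<phi> (adj y * P * y + adj y * Q * z + adj z * Q * y + adj z * R * z))"
  shows "m2_positive (P, Q, Q, R)"
proof -
  have inv: "m2_invertible (P - scaleC w 1, Q, Q, R - scaleC w 1)"
    if w: "w \<notin> complex_of_real ` {0..}" for w
  proof (cases "Im w = 0")
    case True
    define \<epsilon> where "\<epsilon> = - Re w"
    have w\<epsilon>: "w = of_real (- \<epsilon>)" using True by (simp add: \<epsilon>_def complex_eq_iff)
    then have \<epsilon>: "\<epsilon> > 0" using w by (cases "\<epsilon> > 0") auto
    have sh: "X - scaleC w 1 = of_real \<epsilon> + X" for X :: 'b
      unfolding w\<epsilon> scaleC_of_real_one by simp
    have "positive_elem P"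
      by (rule positive_elem_by_states[OF vn PQR(1)]) (use form[of _ _ 0] in simp)
    then have "invertible_elem (of_real \<epsilon> + P)"
      by (rule invertible_elem_of_real_add_positive[OF _ \<epsilon>])
    then obtain P' where P': "(of_real \<epsilon> + P) * P' = 1" "P' * (of_real \<epsilon> + P) = 1"
      by (auto simp: invertible_elem_def)
    have "adj P' * (of_real \<epsilon> + P) = 1"
      using arg_cong[OF P'(1), of adj] by (simp add: adj_mult adj_add PQR)
    then have P'a: "adj P' = P'" by (metis P'(1) mult.assoc mult.left_neutral mult.right_neutral)
    have PP': "P * P' = 1 - \<epsilon> *\<^sub>R P'"
      using P'(1) by (simp add: algebra_simps scaleR_conv_of_real)
    have "positive_elem (R - Q * P' * Q)"
    proof (rule positive_elem_by_states[OF vn])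
      show "adj (R - Q * P' * Q) = R - Q * P' * Q"
        by (simp add: adj_diff adj_mult PQR P'a mult.assoc)
      fix \<phi> :: "'b \<Rightarrow> complex" and b assume \<phi>: "normal_state \<phi>"
      \<comment> \<open>The minimiser in y of the form shifted by \<epsilon> in its P-entry, at z =
        b; the minimum is the Schur complement tested at b.\<close>
      define y where "y = - (P' * Q * b)"
      have y: "adj y = - (adj b * Q * P')" by (simp add: y_def adj_minus adj_mult P'a PQR mult.assoc)
      have "adj y * P * y = adj b * Q * P' * (P * P') * Q * b"
        unfolding y by (simp add: y_def mult.assoc)
      also have "\<dots> = adj b * (Q * P' * Q) * b - \<epsilon> *\<^sub>R (adj y * y)"
        unfolding PP' y by (simp add: y_def algebra_simps)
      finally have "adj b * (R - Q * P' * Q) * b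
          = (adj y * P * y + adj y * Q * b + adj b * Q * y + adj b * R * b) + \<epsilon> *\<^sub>R (adj y * y)"
        unfolding y by (simp add: y_def algebra_simps)
      moreover have "0 \<le> Re (\<phi> (\<epsilon> *\<^sub>R (adj y * y)))"
        using state_positive[OF \<phi> positive_elem_scaleR[OF positive_elem_adj_mult_self]] \<epsilon> by simp
      ultimately show "0 \<le> Re (\<phi> (adj b * (R - Q * P' * Q) * b))"
        using form[OF \<phi>, of y b] by (simp only: state_add[OF \<phi>] plus_complex.sel)
    qed
    then have "invertible_elem (of_real \<epsilon> + (R - Q * P' * Q))"
      by (rule invertible_elem_of_real_add_positive[OF _ \<epsilon>])
    then show ?thesis
      unfolding sh using m2_invertible_Schur[OF P'] by (auto simp: invertible_elem_def add_diff_eq)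
  next
    case False
    have "w \<notin> spectrum P"
      using spectrum_selfadjoint_real[OF PQR(1), of w] False by (metis Im_complex_of_real)
    then obtain P' where P': "(P - scaleC w 1) * P' = 1" "P' * (P - scaleC w 1) = 1"
      by (auto simp: spectrum_iff invertible_elem_def)
    define r where "r = (1/2) *\<^sub>R (P' + adj P')"
    have r: "adj r = r" by (simp add: r_def adj_scaleR adj_add adj_adj add.commute)
    have aP': "(P - scaleC (cnj w) 1) * adj P' = 1"
      using arg_cong[OF P'(2), of adj] by (simp add: adj_mult adj_diff adj_scaleC PQR)
    \<comment> \<open>Resolvent identity between w and its conjugate: the imaginary part of P' is Im
      w times \<open>P' * adj P'\<close>. So that of Q P' Q is Im w times a positive c, and it adds
      to the shift by w instead of cancelling it.\<close>
    have "P' - adj P' = P' * ((P - scaleC (cnj w) 1) * adj P') - (P' * (P - scaleC w 1)) * adj P'"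
      by (simp add: aP' P')
    also have "\<dots> = scaleC (w - cnj w) (P' * adj P')"
      by (simp add: algebra_simps scaleC_mult_left scaleC_mult_right scaleC_diff_left)
    also have "w - cnj w = 2 * (\<i> * of_real (Im w))" by (simp add: complex_eq_iff)
    finally have "P' - adj P' = 2 *\<^sub>R scaleC (\<i> * of_real (Im w)) (P' * adj P')"
      by (simp add: scaleR_scaleC scaleC_scaleC)
    moreover have "P' = r + (1/2) *\<^sub>R (P' - adj P')"
      unfolding r_def by (simp add: algebra_simps flip: scaleR_left_distrib)
    ultimately have P'r: "P' = r + scaleC (\<i> * of_real (Im w)) (P' * adj P')" by simp
    define c where "c = (Q * P') * adj (Q * P')"
    have c: "positive_elem c" unfolding c_def by (rule positive_elem_mult_adj)
    have "Q * P' * Q = Q * r * Q + scaleC (\<i> * of_real (Im w)) c"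
      by (subst P'r) (simp add: c_def adj_mult PQR algebra_simps scaleC_mult_left scaleC_mult_right)
    moreover have "scaleC w (1::'b) = of_real (Re w) + scaleC (\<i> * of_real (Im w)) 1"
      by (subst complex_eq[of w]) (simp add: scaleC_add_left scaleC_of_real_one)
    ultimately have eq: "(R - scaleC w 1) - Q * P' * Q
        = (R - of_real (Re w) - Q * r * Q) - scaleC (\<i> * of_real (Im w)) (1 + c)"
      by (simp add: scaleC_add_right)
    have "invertible_elem ((R - scaleC w 1) - Q * P' * Q)"
      unfolding eq
      by (rule invertible_elem_definite_imaginary_part)
        (use False c in \<open>auto simp: adj_diff adj_mult PQR r mult.assoc\<close>)
    then show ?thesis using m2_invertible_Schur[OF P'] by (auto simp: invertible_elem_def)
  qed
  have "m2_spectrum (P, Q, Q, R) \<subseteq> complex_of_real ` {0..}"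
  proof
    fix w assume "w \<in> m2_spectrum (P, Q, Q, R)"
    then show "w \<in> complex_of_real ` {0..}" using inv[of w] by auto
  qed
  then show ?thesis by (simp add: m2_positive_def PQR)
qed

section \<open>The correlation matrix\<close>

theorem theorem4p4:
  fixes \<Phi> :: "'a::cstar_algebra \<Rightarrow> 'b::cstar_algebra"
    and \<rho> A B :: 'a
    and f g :: "real \<Rightarrow> real"
    and I :: "real set"
  assumes vnA: "vn_algebra TYPE('a)" and vnB: "vn_algebra TYPE('b)"
    and lin: "linear_map \<Phi>" and pos: "positive_map \<Phi>" and tr: "tracial \<Phi>"
    and rho_sa: "selfadjoint \<rho>"
    and I_int: "is_interval I" and spec: "spectrum \<rho> \<subseteq> complex_of_real ` I"
    and f_cont: "continuous_on I f" and g_cont: "continuous_on I g"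
    and same: "same_monotonic f g I"
    and A_sa: "selfadjoint A" and B_sa: "selfadjoint B"
  shows "(SkewI \<rho> \<Phi> f g A, CorrSym \<rho> \<Phi> f g A B, CorrSym \<rho> \<Phi> f g B A, SkewI \<rho> \<Phi> f g B)
           = (SkewI \<rho> \<Phi> f g A, Re_elem (Corr \<rho> \<Phi> f g A B), Re_elem (Corr \<rho> \<Phi> f g A B), SkewI \<rho> \<Phi> f g B)
       \<and> m2_positive (SkewI \<rho> \<Phi> f g A, Re_elem (Corr \<rho> \<Phi> f g A B), Re_elem (Corr \<rho> \<Phi> f g A B), SkewI \<rho> \<Phi> f g B)"
proof -
  have sa: "adj \<rho> = \<rho>" "adj A = A" "adj B = B"
    using rho_sa A_sa B_sa by (simp_all add: selfadjoint_def)
  have K: "Re ` spectrum \<rho> \<subseteq> I" using spec by auto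
  have fK: "continuous_on (Re ` spectrum \<rho>) f" and gK: "continuous_on (Re ` spectrum \<rho>) g"
    using f_cont g_cont K by (blast intro: continuous_on_subset)+
  define a where "a = cfc f \<rho>"
  define b where "b = cfc g \<rho>"
  have ab: "adj a = a" "adj b = b" "b * a = a * b"
    unfolding a_def b_def by (intro adj_cfc cfc_commute sa(1) fK gK)+
  define D where "D X Y = a * b * X * Y - a * X * b * Y" for X Y
  have Corr: "Corr \<rho> \<Phi> f g X Y = \<Phi> (D X Y)" if "adj X = X" for X Y
    using that by (simp add: Corr_def D_def a_def b_def linear_diff[OF linear_map_linear[OF lin]])
  \<comment> \<open>Traciality cycles a b, respectively a, back to the front of the adjoint words.
    This symmetry turns the symmetrised correlation into a real part.\<close>
  have adj_Corr: "adj (Corr \<rho> \<Phi> f g X Y) = Corr \<rho> \<Phi> f g Y X" if XY: "adj X = X" "adj Y = Y" for X Y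
  proof -
    have "adj (D X Y) = (Y * X) * (a * b) - (Y * b * X) * a"
      by (simp add: D_def adj_diff adj_mult XY ab mult.assoc)
    then have "\<Phi> (adj (D X Y)) = \<Phi> ((Y * X) * (a * b)) - \<Phi> ((Y * b * X) * a)"
      by (simp add: linear_diff[OF linear_map_linear[OF lin]])
    also have "\<Phi> ((Y * X) * (a * b)) = \<Phi> ((a * b) * (Y * X))"
      using tr unfolding tracial_def by blast
    also have "\<Phi> ((Y * b * X) * a) = \<Phi> (a * (Y * b * X))"
      using tr unfolding tracial_def by blast
    finally show ?thesis
      by (simp add: Corr XY positive_map_adj[OF lin pos, symmetric])
        (simp add: D_def mult.assoc linear_diff[OF linear_map_linear[OF lin]])
  qed
  define C where "C = Corr \<rho> \<Phi> f g A B"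
  have sym: "CorrSym \<rho> \<Phi> f g A B = Re_elem C" "CorrSym \<rho> \<Phi> f g B A = Re_elem C"
    using adj_Corr[of A B] sa by (simp_all add: CorrSym_def Re_elem_def C_def add.commute)
  have "m2_positive (SkewI \<rho> \<Phi> f g A, Re_elem C, Re_elem C, SkewI \<rho> \<Phi> f g B)"
  proof (rule m2_positiveI[OF vnB])
    show "adj (SkewI \<rho> \<Phi> f g A) = SkewI \<rho> \<Phi> f g A" "adj (SkewI \<rho> \<Phi> f g B) = SkewI \<rho> \<Phi> f g B"
      using adj_Corr sa by (simp_all add: SkewI_def)
    show "adj (Re_elem C) = Re_elem C"
      by (simp add: Re_elem_def adj_scaleC adj_add adj_adj add.commute)
    fix \<phi> :: "'b \<Rightarrow> complex" and y z assume \<phi>: "normal_state \<phi>"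
    interpret tracial_form "\<lambda>x. Re (\<phi> (adj y * \<Phi> x * y))"
      "\<lambda>x. (Re (\<phi> (adj y * \<Phi> x * z)) + Re (\<phi> (adj z * \<Phi> x * y))) / 2"
      "\<lambda>x. Re (\<phi> (adj z * \<Phi> x * z))"
      by (rule tracial_form_state[OF lin pos tr \<phi>])
    have "0 \<le> Re (\<phi> (adj y * \<Phi> (D A A) * y))
        + 2 * ((Re (\<phi> (adj y * \<Phi> (D A B) * z)) + Re (\<phi> (adj z * \<Phi> (D A B) * y))) / 2)
        + Re (\<phi> (adj z * \<Phi> (D B B) * z))"
      unfolding D_def a_def b_def
      using same K by (intro skew_form_nonneg sa fK gK) (auto simp: same_monotonic_def)
    then have "0 \<le> Re (\<phi> (adj y * SkewI \<rho> \<Phi> f g A * y)) + Re (\<phi> (adj y * C * z)) + Re (\<phi> (adj z * C * y))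
        + Re (\<phi> (adj z * SkewI \<rho> \<Phi> f g B * z))"
      unfolding SkewI_def C_def Corr[OF sa(2)] Corr[OF sa(3)]
      by (simp only: times_divide_eq_right nonzero_mult_div_cancel_left[OF zero_neq_numeral[symmetric]] add.assoc)
    \<comment> \<open>The state at \<open>adj v * adj C * w\<close> is the conjugate of the state at
      \<open>adj w * C * v\<close>, so replacing C by its real part averages the two cross terms and
      preserves the real part of their sum.\<close>
    moreover have "Re (\<phi> (adj y * Re_elem C * z)) + Re (\<phi> (adj z * Re_elem C * y))
        = Re (\<phi> (adj y * C * z)) + Re (\<phi> (adj z * C * y))"
    proof -
      have eq: "\<phi> (adj v * Re_elem C * w) = (\<phi> (adj v * C * w) + cnj (\<phi> (adj w * C * v))) / 2" for v w
        using state_adj[OF \<phi>, of "adj w * C * v"]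
        by (simp add: Re_elem_def scaleC_mult_left scaleC_mult_right state_scaleC[OF \<phi>] distrib_left
            distrib_right state_add[OF \<phi>] adj_mult adj_adj mult.assoc)
      have "Re (\<phi> (adj v * Re_elem C * w)) = Re (\<phi> (adj v * C * w)) / 2 + Re (\<phi> (adj w * C * v)) / 2" for v w
        unfolding eq by (simp add: add_divide_distrib)
      from this[of y z] this[of z y] show ?thesis by simp
    qed
    ultimately show "0 \<le> Re (\<phi> (adj y * SkewI \<rho> \<Phi> f g A * y + adj y * Re_elem C * z
        + adj z * Re_elem C * y + adj z * SkewI \<rho> \<Phi> f g B * z))"
      by (simp add: state_add[OF \<phi>] add.assoc)
  qed
  then show ?thesis using sym by (simp add: C_def)
qed

end
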